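(* For every $k\in\mathbb{N}$ let $G_k:=\bigcup_{j\in\mathbb{Z}}\left(j\cdot 2^{-k^2},\, j\cdot 2^{-k^2}+2^{-k^3}\right)$, let $$F_0:=[0,1/2]\setminus\bigcup_{k=2}^\infty G_k,$$ and let $F:=F_0\times F_0\subseteq\mathbb{R}^2$. Then $D_*(\alpha,F)=1$ for every $\alpha\in(0,1]$, and $D_*(0,F)=0$.
   Context: For $0<\alpha\le 1$, a function $f:F\to\mathbb{R}$ is $1$-Hölder-$\alpha$ if $|f(x)-f(y)|\le |x-y|^\alpha$ for all $x,y\in F$. $C_1^\alpha(F)$ denotes the set of all $1$-Hölder-$\alpha$ functions on $F$, equipped with the metric of the supremum norm. $\lambda$ is one-dimensional Lebesgue measure and $\dim_H$ is Hausdorff dimension (in the definition of $D^f$ below, $\dim_H\emptyset=\inf\{s\ge 0:\mathcal H^s(\emptyset)=0\}=0$). For $f:F\to\mathbb{R}$ and $r\in\mathbb{R}$ put $D^f(r,F)=\dim_H(f^{-1}(r))$ and $$D_*^f(F)=\sup\{d:\lambda\{r: D^f(r,F)\ge d\}>0\}.$$ Let $\mathfrak{G}_{1,\alpha}(F)$ be the family of all dense $G_\delta$ subsets of $C_1^\alpha(F)$, and for $0<\alpha\le 1$ set $$D_*(\alpha,F)=\sup_{\mathcal{G}\in\mathfrak{G}_{1,\alpha}(F)}\inf\{D_*^f(F): f\in\mathcal{G}\}.$$ For $\alpha=0$ set $D_*(0,F)=\max\{0,\dim_{tH}F-1\}$, where $\dim_{tH}$ is the topological Hausdorff dimension: $\dim_{tH}\emptyset=-1$,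 and for a non-empty metric space $X$, $\dim_{tH}X=\inf\{d: X$ has a basis $\mathcal{U}$ (of open sets) such that $\dim_H\partial U\le d-1$ for every $U\in\mathcal{U}\}$, with the convention $\dim_H\emptyset=-1$ in this last definition. *)

theory Defs
  imports "HOL-Analysis.Analysis"
begin

section \<open>Hausdorff measure and Hausdorff dimension\<close>

text \<open>The \<open>s\<close>-th power of the diameter, with the usual conventions \<open>0\<^sup>0 = 1\<close> for non-empty sets
  (so that \<open>s = 0\<close> gives counting measure) and value \<open>0\<close> for the empty set. They are explicit
  because \<open>0 powr 0 = 0\<close> in HOL.\<close>

definition diam_power :: "real \<Rightarrow> 'a::metric_space set \<Rightarrow> ennreal" where
  "diam_power s U =
     (if U = {} then 0 else if s = 0 then 1 else ennreal (diameter U powr s))"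

text \<open>Boundedness is required separately, since \<^const>\<open>diameter\<close> is unspecified on unbounded sets.\<close>

definition delta_covers :: "real \<Rightarrow> 'a::metric_space set \<Rightarrow> (nat \<Rightarrow> 'a set) set" where
  "delta_covers \<delta> A =
     {U. (\<forall>i. bounded (U i) \<and> diameter (U i) \<le> \<delta>) \<and> A \<subseteq> (\<Union>i. U i)}"

definition hausdorff_measure :: "real \<Rightarrow> 'a::metric_space set \<Rightarrow> ennreal" where
  "hausdorff_measure s A =
     (SUP \<delta>\<in>{0<..}. INF U\<in>delta_covers \<delta> A. \<Sum>i. diam_power s (U i))"

definition hausdorff_dim :: "'a::metric_space set \<Rightarrow> ereal" where
  "hausdorff_dim A = Inf {ereal s | s. 0 \<le> s \<and> hausdorff_measure s A = 0}"

section \<open>Topological Hausdorff dimension\<close>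

text \<open>The Hausdorff dimension with the convention that the empty set has dimension \<open>-1\<close>,
  which is used only for boundaries of basis elements.\<close>

definition hausdorff_dim_bd :: "'a::metric_space set \<Rightarrow> ereal" where
  "hausdorff_dim_bd A = (if A = {} then - 1 else hausdorff_dim A)"

definition basis_of :: "'a topology \<Rightarrow> 'a set set \<Rightarrow> bool" where
  "basis_of T \<U> \<longleftrightarrow>
     (\<forall>U\<in>\<U>. openin T U) \<and> (\<forall>W. openin T W \<longrightarrow> (\<exists>\<U>'. \<U>' \<subseteq> \<U> \<and> \<Union>\<U>' = W))"

text \<open>A set \<open>X\<close> is regarded as a metric space in its own right: open sets and boundaries are
  those of the subspace topology.\<close>

definition top_hausdorff_dim :: "'a::metric_space set \<Rightarrow> ereal" where
  "top_hausdorff_dim X =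
     (if X = {} then - 1
      else Inf {d. \<exists>\<U>. basis_of (top_of_set X) \<U> \<and>
                        (\<forall>U\<in>\<U>. hausdorff_dim_bd (top_of_set X frontier_of U) \<le> d - 1)})"

section \<open>The space of \<open>1\<close>-Hoelder-\<open>\<alpha>\<close> functions\<close>

text \<open>Functions on \<open>F\<close> are represented by total functions that are \<^const>\<open>undefined\<close> outside \<open>F\<close>.\<close>

definition holder_functions :: "real \<Rightarrow> 'a::metric_space set \<Rightarrow> ('a \<Rightarrow> real) set" where
  "holder_functions \<alpha> F =
     {f \<in> extensional F. \<forall>x\<in>F. \<forall>y\<in>F. \<bar>f x - f y\<bar> \<le> dist x y powr \<alpha>}"

text \<open>\<^const>\<open>funspace\<close> is the space of bounded functions with the supremum metric; for bounded
  \<open>F\<close> this imposes nothing beyond the Hoelder condition, see the lemma below.\<close>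

definition holder_space :: "real \<Rightarrow> 'a::metric_space set \<Rightarrow> ('a \<Rightarrow> real) metric" where
  "holder_space \<alpha> F = submetric (funspace F euclidean_metric) (holder_functions \<alpha> F)"

lemma mspace_holder_space:
  assumes "bounded F" and "0 < \<alpha>"
  shows "mspace (holder_space \<alpha> F) = holder_functions \<alpha> F"
proof -
  have "bounded (f ` F)" if f: "f \<in> holder_functions \<alpha> F" for f
  proof (cases "F = {}")
    case False
    then obtain a where a: "a \<in> F" by blast
    obtain B where B: "\<And>x. x \<in> F \<Longrightarrow> dist a x \<le> B"
      using assms(1) bounded_any_center[of F a] by auto
    have "dist (f a) y \<le> B powr \<alpha>" if "y \<in> f ` F" for y
    proof -
      from that obtain x where x: "x \<in> F" "y = f x" by blast
      have "dist (f a) y \<le> dist a x powr \<alpha>"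
        using f a x by (auto simp: holder_functions_def dist_real_def)
      also have "\<dots> \<le> B powr \<alpha>"
        using B[OF x(1)] assms(2) by (intro powr_mono2) auto
      finally show ?thesis .
    qed
    then show ?thesis unfolding bounded_def by blast
  qed simp
  then show ?thesis
    by (auto simp: holder_space_def Met_TC.fspace_def
        holder_functions_def)
qed

lemma mdist_holder_space:
  assumes "f \<in> mspace (holder_space \<alpha> F)" and "g \<in> mspace (holder_space \<alpha> F)"
    and "F \<noteq> {}"
  shows "mdist (holder_space \<alpha> F) f g = (SUP x\<in>F. \<bar>f x - g x\<bar>)"
  using assms by (simp add: holder_space_def Met_TC.fdist_def dist_real_def)

definition dense_gdelta_sets :: "real \<Rightarrow> 'a::metric_space set \<Rightarrow> ('a \<Rightarrow> real) set set" where
  "dense_gdelta_sets \<alpha> F =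
     {\<G>. gdelta_in (mtopology_of (holder_space \<alpha> F)) \<G> \<and>
          mtopology_of (holder_space \<alpha> F) closure_of \<G> = mspace (holder_space \<alpha> F)}"

section \<open>Generic dimension of level sets\<close>

definition level_dim :: "('a::metric_space \<Rightarrow> real) \<Rightarrow> real \<Rightarrow> 'a set \<Rightarrow> ereal" where
  "level_dim f r F = hausdorff_dim {x \<in> F. f x = r}"

text \<open>For compact \<open>F\<close> and continuous \<open>f\<close> the set of levels is Borel, so the value \<open>0\<close> which
  \<^const>\<open>emeasure\<close> assigns to non-measurable sets plays no role.\<close>

definition D_star_fun :: "('a::metric_space \<Rightarrow> real) \<Rightarrow> 'a set \<Rightarrow> ereal" where
  "D_star_fun f F = Sup {d. emeasure lebesgue {r. level_dim f r F \<ge> d} > 0}"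

definition D_star :: "real \<Rightarrow> 'a::metric_space set \<Rightarrow> ereal" where
  "D_star \<alpha> F =
     (if \<alpha> = 0 then max 0 (top_hausdorff_dim F - 1)
      else SUP \<G>\<in>dense_gdelta_sets \<alpha> F. INF f\<in>\<G>. D_star_fun f F)"

section \<open>The fractal\<close>

definition gaps :: "nat \<Rightarrow> real set" where
  "gaps k = (\<Union>j::int. {of_int j * (1/2) ^ (k^2) <..< of_int j * (1/2) ^ (k^2) + (1/2) ^ (k^3)})"

definition F0 :: "real set" where
  "F0 = {0..1/2} - (\<Union>k\<in>{2..}. gaps k)"

text \<open>The plane is the product type, whose distance is the Euclidean one.\<close>

definition F_square :: "(real \<times> real) set" where
  "F_square = F0 \<times> F0"

end

theory Submission
  imports Defs
begin

text \<open>
  A gap of level \<open>k\<close> of \<^const>\<open>F0\<close> has length \<open>(1/2)^(k^3)\<close>, but gaps of that level occur only at the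
  multiples of \<open>(1/2)^(k^2)\<close>. So \<^const>\<open>F0\<close> is totally disconnected and has positive length, and for
  every \<open>\<alpha> > 0\<close> even the sum of the \<open>\<alpha>\<close>-th powers of its gap lengths converges, extremely fast.
  Both halves of the theorem come from this: topologically the gaps destroy all connectedness,
  while a Hoelder function on \<^const>\<open>F_square\<close> cannot exploit them.

  Lower bound for \<open>0 < \<alpha> \<le> 1\<close>. Restricted to a column \<open>{x} \<times> F0\<close>, a \<open>1\<close>-Hoelder-\<open>\<alpha>\<close> function \<open>f\<close> can
  skip values only at the gaps, and at a gap it skips at most the \<open>\<alpha>\<close>-th power of the gap length. In the
  window between \<open>1/2 - (1/2)^(n^2)\<close> and \<open>1/2\<close> the skipped values have total length at most the length of the
  window times \<open>gap_tail \<alpha> n\<close>, which tends to \<open>0\<close> (\<open>emeasure_range_window\<close>). Suppose that on a set of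
  columns of positive length the values of \<open>f\<close> at the ends of some window differ by definitely more than
  that. Then each of these columns attains a set of levels of length bounded below, and by Fubini a set
  of levels of positive length is attained on positively many columns. Such a level set has a projection
  of positive length, hence dimension at least \<open>1\<close> (\<open>D_star_fun_oscillating\<close>). The condition on \<open>f\<close> is
  open, and it is dense: if \<open>f\<close> violates it, then \<open>(1 - \<epsilon>) f + \<epsilon> y\<close> satisfies it, since \<open>\<epsilon>\<close> exceeds
  \<open>gap_tail \<alpha> n\<close> for large \<open>n\<close> (\<open>tilt_oscillating\<close>).

  Upper bound for \<open>0 < \<alpha> \<le> 1\<close>. For a Lipschitz function \<open>g\<close> a square of side \<open>1/N\<close> is met by level sets
  only for a set of levels of length of order \<open>1/N\<close>, so on average a level set meets about \<open>N\<close> of the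
  \<open>N\<^sup>2\<close> squares and is at most one-dimensional. The count survives if \<open>g\<close> is replaced by any \<open>f\<close> within
  distance \<open>1/N\<close> of it (\<open>level_cover_energy\<close>). Lipschitz functions are dense in the space of
  \<open>1\<close>-Hoelder-\<open>\<alpha>\<close> functions (\<open>lipschitz_approximation\<close>), so a generic \<open>f\<close> is approximated in this way at
  infinitely many scales, with Lipschitz constants that are negligible compared to every positive power
  of \<open>N\<close>; then almost every level set of \<open>f\<close> has dimension at most \<open>1\<close>. By the Baire category theorem every
  dense \<open>G\<^sub>\<delta>\<close> set contains such an \<open>f\<close>.

  For \<open>\<alpha> = 0\<close>, points outside \<^const>\<open>F0\<close> are dense, so rectangles with such corners are relatively clopen
  and form a basis with empty boundaries; the topological Hausdorff dimension is at most \<open>0\<close>.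
\<close>

section \<open>Sets of vanishing Hausdorff measure\<close>

lemma diam_power_empty [simp]: "diam_power s {} = 0"
  by (simp add: diam_power_def)

lemma delta_coversI:
  "(\<And>i. bounded (U i)) \<Longrightarrow> (\<And>i. diameter (U i) \<le> \<delta>) \<Longrightarrow> A \<subseteq> (\<Union>i. U i) \<Longrightarrow> U \<in> delta_covers \<delta> A"
  by (simp add: delta_covers_def)

lemma delta_covers_mono: "U \<in> delta_covers a A \<Longrightarrow> a \<le> b \<Longrightarrow> U \<in> delta_covers b A"
  unfolding delta_covers_def using order_trans by blast

text \<open>One \<open>\<epsilon>\<close> bounds both the diameters and the sum, so that a null set is described by a single
  sequence of covers.\<close>

lemma hausdorff_measure_eq_0_iff:
  "hausdorff_measure s A = 0 \<longleftrightarrow>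
     (\<forall>\<epsilon>>0. \<exists>U\<in>delta_covers \<epsilon> A. (\<Sum>i. diam_power s (U i)) < ennreal \<epsilon>)"
proof
  assume 0: "hausdorff_measure s A = 0"
  show "\<forall>\<epsilon>>0. \<exists>U\<in>delta_covers \<epsilon> A. (\<Sum>i. diam_power s (U i)) < ennreal \<epsilon>"
  proof (intro allI impI)
    fix \<epsilon> :: real assume "0 < \<epsilon>"
    then have "(INF U\<in>delta_covers \<epsilon> A. \<Sum>i. diam_power s (U i)) \<le> hausdorff_measure s A"
      unfolding hausdorff_measure_def by (intro SUP_upper) auto
    then have "(INF U\<in>delta_covers \<epsilon> A. \<Sum>i. diam_power s (U i)) < ennreal \<epsilon>"
      using 0 \<open>0 < \<epsilon>\<close> by (simp add: ennreal_less_zero_iff)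
    then show "\<exists>U\<in>delta_covers \<epsilon> A. (\<Sum>i. diam_power s (U i)) < ennreal \<epsilon>"
      by (simp add: INF_less_iff)
  qed
next
  assume *: "\<forall>\<epsilon>>0. \<exists>U\<in>delta_covers \<epsilon> A. (\<Sum>i. diam_power s (U i)) < ennreal \<epsilon>"
  have "(INF U\<in>delta_covers \<delta> A. \<Sum>i. diam_power s (U i)) \<le> 0" if "0 < \<delta>" for \<delta>
  proof (rule ennreal_le_epsilon)
    fix e :: real assume "0 < e"
    then obtain U where U: "U \<in> delta_covers (min \<delta> e) A" "(\<Sum>i. diam_power s (U i)) < ennreal (min \<delta> e)"
      using * \<open>0 < \<delta>\<close> by (meson min_less_iff_conj)
    have "U \<in> delta_covers \<delta> A" using U(1) by (rule delta_covers_mono) simp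
    then have "(INF U\<in>delta_covers \<delta> A. \<Sum>i. diam_power s (U i)) \<le> (\<Sum>i. diam_power s (U i))"
      by (rule INF_lower)
    also have "\<dots> \<le> ennreal e" using U(2) by (meson ennreal_leI less_imp_le min.cobounded2 order_trans)
    finally show "(INF U\<in>delta_covers \<delta> A. \<Sum>i. diam_power s (U i)) \<le> 0 + ennreal e" by simp
  qed
  then have "hausdorff_measure s A \<le> 0"
    unfolding hausdorff_measure_def by (intro SUP_least) auto
  then show "hausdorff_measure s A = 0" by simp
qed

lemma diam_power_antimono:
  assumes "0 \<le> s" "s \<le> t" "bounded U" "diameter U \<le> 1"
  shows "diam_power t U \<le> diam_power s U"
proof -
  have d: "0 \<le> diameter U" using assms by (simp add: diameter_ge_0)
  have "diameter U powr t \<le> diameter U powr s"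
    using assms d by (cases "diameter U = 0") (auto intro: powr_mono')
  moreover have "diameter U powr t \<le> 1"
    using powr_mono_both[of 0 t "diameter U" 1] assms d
    by (cases "diameter U = 0") (auto intro: powr_le1)
  ultimately show ?thesis
    using assms by (auto simp: diam_power_def ennreal_leI)
qed

lemma hausdorff_measure_eq_0_mono:
  assumes "0 \<le> s" "s \<le> t" "hausdorff_measure s A = 0"
  shows "hausdorff_measure t A = 0"
  unfolding hausdorff_measure_eq_0_iff
proof (intro allI impI)
  fix \<epsilon> :: real assume "0 < \<epsilon>"
  then obtain U where U: "U \<in> delta_covers (min 1 \<epsilon>) A" "(\<Sum>i. diam_power s (U i)) < ennreal (min 1 \<epsilon>)"
    using assms(3) unfolding hausdorff_measure_eq_0_iff by (metis min_less_iff_conj zero_less_one)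
  have "(\<Sum>i. diam_power t (U i)) \<le> (\<Sum>i. diam_power s (U i))"
    using U(1) assms by (intro suminf_le diam_power_antimono summableI) (auto simp: delta_covers_def)
  also have "\<dots> < ennreal \<epsilon>" using U(2) by (metis ennreal_leI less_le_trans min.cobounded2)
  finally show "\<exists>U\<in>delta_covers \<epsilon> A. (\<Sum>i. diam_power t (U i)) < ennreal \<epsilon>"
    using delta_covers_mono[OF U(1), of \<epsilon>] by auto
qed

text \<open>Rational exponents suffice because vanishing of the Hausdorff measure is inherited by larger
  exponents; this makes conditions on the dimension countable combinations of conditions on measures.\<close>

lemma hausdorff_dim_less_iff:
  "hausdorff_dim A < ereal d \<longleftrightarrow> (\<exists>q\<in>\<rat>. 0 \<le> q \<and> q < d \<and> hausdorff_measure q A = 0)"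
proof
  assume "hausdorff_dim A < ereal d"
  then obtain s where s: "0 \<le> s" "hausdorff_measure s A = 0" "s < d"
    unfolding hausdorff_dim_def Inf_less_iff by auto
  obtain q where q: "q \<in> \<rat>" "s < q" "q < d" using Rats_dense_in_real[OF s(3)] by auto
  have "hausdorff_measure q A = 0"
    using q(2) by (intro hausdorff_measure_eq_0_mono[OF s(1) _ s(2)]) simp
  with q s(1) show "\<exists>q\<in>\<rat>. 0 \<le> q \<and> q < d \<and> hausdorff_measure q A = 0" by force
next
  assume "\<exists>q\<in>\<rat>. 0 \<le> q \<and> q < d \<and> hausdorff_measure q A = 0"
  then show "hausdorff_dim A < ereal d"
    unfolding hausdorff_dim_def Inf_less_iff by auto
qed

lemma bounded_in_open_enlarged:
  fixes A :: "'a::metric_space set"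
  assumes "bounded A" "0 < e"
  shows "\<exists>V. open V \<and> A \<subseteq> V \<and> bounded V \<and> diameter V \<le> diameter A + e"
proof (cases "A = {}")
  case True
  then show ?thesis using assms by (intro exI[of _ "{}"]) auto
next
  case False
  define V where "V = (\<Union>x\<in>A. ball x (e/2))"
  have dd: "dist x y \<le> diameter A + e" if xy: "x \<in> V" "y \<in> V" for x y
  proof -
    obtain x' where "x' \<in> A" "dist x' x < e/2"
      using xy(1) unfolding V_def UN_iff mem_ball by blast
    moreover obtain y' where "y' \<in> A" "dist y' y < e/2"
      using xy(2) unfolding V_def UN_iff mem_ball by blast
    moreover have "dist x' y' \<le> diameter A"
      using calculation assms by (intro diameter_bounded_bound) auto
    moreover have "dist x y \<le> dist x' x + dist x' y' + dist y' y"
      using dist_triangle[of x y x'] dist_triangle[of x' y y'] by (simp add: dist_commute)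
    ultimately show ?thesis by linarith
  qed
  have "V \<noteq> {}" using False assms by (force simp: V_def)
  then have "(SUP (x, y)\<in>V \<times> V. dist x y) \<le> diameter A + e"
    using dd by (intro cSUP_least) auto
  then have "diameter V \<le> diameter A + e"
    using \<open>V \<noteq> {}\<close> by (simp add: diameter_def[of V])
  moreover have "bounded V" using dd by (auto simp: bounded_two_points)
  moreover have "A \<subseteq> V" using assms by (auto simp: V_def)
  ultimately show ?thesis unfolding V_def by (intro exI[of _ V]) (auto simp: V_def)
qed

text \<open>For \<open>s > 0\<close> this is continuity of \<open>t \<mapsto> t powr s\<close> at the diameter. For \<open>s = 0\<close> the power does not see
  the enlargement, as long as the empty set is enlarged to the empty set.\<close>

lemma diam_power_open_enlarged:
  fixes A :: "'a::metric_space set"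
  assumes "bounded A" "0 \<le> s" "0 < e"
  shows "\<exists>V. open V \<and> A \<subseteq> V \<and> bounded V \<and> diameter V \<le> diameter A + e
           \<and> diam_power s V \<le> diam_power s A + ennreal e"
proof (cases "A = {} \<or> s = 0")
  case True
  obtain V where V: "open V" "A \<subseteq> V" "bounded V" "diameter V \<le> diameter A + e"
    using bounded_in_open_enlarged[OF assms(1,3)] by auto
  show ?thesis
  proof (cases "A = {}")
    case True
    then show ?thesis using assms by (intro exI[of _ "{}"]) auto
  next
    case False
    then show ?thesis using V \<open>A = {} \<or> s = 0\<close> by (intro exI[of _ V]) (auto simp: diam_power_def)
  qed
next
  case False
  then have s: "0 < s" "A \<noteq> {}" using assms by auto
  have d0: "0 \<le> diameter A" using assms by (simp add: diameter_ge_0)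
  have "continuous_on {0..} (\<lambda>x::real. x powr s)"
    using s by (intro continuous_on_powr') (auto intro!: continuous_intros)
  then obtain \<eta> where \<eta>: "0 < \<eta>" "\<And>x. 0 \<le> x \<Longrightarrow> \<bar>x - diameter A\<bar> < \<eta> \<Longrightarrow> \<bar>x powr s - diameter A powr s\<bar> < e"
    unfolding continuous_on_iff dist_real_def using d0 assms(3) by (metis atLeast_iff)
  define h where "h = min (\<eta>/2) e"
  have h: "0 < h" "h < \<eta>" "h \<le> e" using \<eta> assms by (auto simp: h_def)
  obtain V where V: "open V" "A \<subseteq> V" "bounded V" "diameter V \<le> diameter A + h"
    using bounded_in_open_enlarged[OF assms(1) h(1)] by auto
  have dV: "0 \<le> diameter V" using V by (simp add: diameter_ge_0)
  have "diameter V powr s \<le> (diameter A + h) powr s"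
    using V dV s by (intro powr_mono2) auto
  also have "\<dots> \<le> diameter A powr s + e"
    using \<eta>(2)[of "diameter A + h"] h d0 by auto
  finally have "ennreal (diameter V powr s) \<le> ennreal (diameter A powr s + e)" by (rule ennreal_leI)
  also have "\<dots> = ennreal (diameter A powr s) + ennreal e" using assms by simp
  finally have "ennreal (diameter V powr s) \<le> ennreal (diameter A powr s) + ennreal e" .
  then show ?thesis using V s h by (intro exI[of _ V]) (auto simp: diam_power_def)
qed

text \<open>The levels whose level set leaves \<open>W\<close> form a continuous image of the compact set \<open>F - W\<close>.\<close>

lemma open_levels_covered:
  fixes f :: "'a::metric_space \<Rightarrow> real"
  assumes F: "compact F" and f: "continuous_on F f" and W: "open W"
  shows "open {r. {x \<in> F. f x = r} \<subseteq> W}"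
proof -
  have "compact (f ` (F - W))"
    using F f W by (intro compact_continuous_image compact_diff) (auto intro: continuous_on_subset)
  then have "open (- f ` (F - W))" by (simp add: compact_imp_closed open_Compl)
  moreover have "{r. {x \<in> F. f x = r} \<subseteq> W} = - f ` (F - W)" by auto
  ultimately show ?thesis by simp
qed

lemma hausdorff_measure_eq_0_iff_open_covers:
  fixes A :: "'a::metric_space set"
  assumes "0 \<le> s"
  shows "hausdorff_measure s A = 0 \<longleftrightarrow>
    (\<forall>n. \<exists>U\<in>delta_covers (1 / Suc n) A. (\<forall>i. open (U i)) \<and> (\<Sum>i. diam_power s (U i)) < ennreal (1 / Suc n))"
    (is "_ \<longleftrightarrow> (\<forall>n. ?P n)")
proof
  assume 0: "hausdorff_measure s A = 0"
  show "\<forall>n. ?P n"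
  proof
    fix n
    \<comment> \<open>The other half of \<open>1 / Suc n\<close> is left for the enlargements \<open>h i\<close>, whose sum is \<open>\<epsilon>\<close>.\<close>
    define \<epsilon> where "\<epsilon> = 1 / (2 * real (Suc n))"
    have \<epsilon>: "0 < \<epsilon>" by (simp add: \<epsilon>_def)
    then obtain U where U: "U \<in> delta_covers \<epsilon> A" "(\<Sum>i. diam_power s (U i)) < ennreal \<epsilon>"
      using 0 unfolding hausdorff_measure_eq_0_iff by metis
    define h where "h i = \<epsilon> * (1/2) ^ Suc i" for i :: nat
    have h: "0 < h i" "h i \<le> \<epsilon>" for i
      using \<epsilon> power_le_one[of "1/2::real" "Suc i"] unfolding h_def
      by (auto intro: mult_left_le simp del: power_Suc)
    have "\<forall>i. \<exists>V. open V \<and> U i \<subseteq> V \<and> bounded V \<and> diameter V \<le> diameter (U i) + h i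
           \<and> diam_power s V \<le> diam_power s (U i) + ennreal (h i)"
      using U(1) assms h by (intro allI diam_power_open_enlarged) (auto simp: delta_covers_def)
    then obtain V where V: "\<And>i. open (V i)" "\<And>i. U i \<subseteq> V i" "\<And>i. bounded (V i)"
      "\<And>i. diameter (V i) \<le> diameter (U i) + h i"
      "\<And>i. diam_power s (V i) \<le> diam_power s (U i) + ennreal (h i)" by metis
    have "diameter (V i) \<le> 1 / Suc n" for i
    proof -
      have "diameter (U i) \<le> \<epsilon>" using U(1) by (simp add: delta_covers_def)
      then have "diameter (V i) \<le> \<epsilon> + \<epsilon>" using V(4)[of i] h(2)[of i] by linarith
      also have "\<dots> = 1 / Suc n" by (simp add: \<epsilon>_def field_simps)
      finally show ?thesis .
    qed
    then have "V \<in> delta_covers (1 / Suc n) A"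
      using U(1) V(2,3) by (fastforce simp: delta_covers_def)
    moreover have "(\<Sum>i. diam_power s (V i)) < ennreal (1 / Suc n)"
    proof -
      have "(\<Sum>i. diam_power s (V i)) \<le> (\<Sum>i. diam_power s (U i) + ennreal (h i))"
        using V(5) by (intro suminf_le summableI)
      also have "\<dots> = (\<Sum>i. diam_power s (U i)) + (\<Sum>i. ennreal (h i))"
        by (intro suminf_add[symmetric] summableI)
      also have "(\<Sum>i. ennreal (h i)) = ennreal (\<epsilon> * 1)"
        unfolding h_def using \<epsilon> power_half_series
        by (intro suminf_ennreal_eq sums_mult) auto
      also have "(\<Sum>i. diam_power s (U i)) + ennreal (\<epsilon> * 1) < ennreal \<epsilon> + ennreal \<epsilon>"
        using U(2) by (simp add: ennreal_add_left_cancel_less add.commute)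
      also have "\<dots> = ennreal (1 / Suc n)"
        using \<epsilon> by (subst ennreal_plus[symmetric]) (auto simp: \<epsilon>_def field_simps)
      finally show ?thesis .
    qed
    ultimately show "?P n" using V(1) by blast
  qed
next
  assume P: "\<forall>n. ?P n"
  show "hausdorff_measure s A = 0"
    unfolding hausdorff_measure_eq_0_iff
  proof (intro allI impI)
    fix \<epsilon> :: real assume "0 < \<epsilon>"
    then obtain n where n: "1 / real (Suc n) < \<epsilon>" using nat_approx_posE by metis
    from P obtain U where U: "U \<in> delta_covers (1 / Suc n) A" "(\<Sum>i. diam_power s (U i)) < ennreal (1 / Suc n)"
      by metis
    have "(\<Sum>i. diam_power s (U i)) < ennreal \<epsilon>"
      using U(2) n by (metis ennreal_leI less_imp_le less_le_trans)
    then show "\<exists>U\<in>delta_covers \<epsilon> A. (\<Sum>i. diam_power s (U i)) < ennreal \<epsilon>"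
      using delta_covers_mono[OF U(1) less_imp_le[OF n]] by blast
  qed
qed

text \<open>For each exponent the levels with a null level set form a \<open>G\<^sub>\<delta>\<close> set: a level set with a small
  cover by open sets shares this cover with all nearby level sets. Measurability is essential for
  lower bounds on \<^const>\<open>D_star_fun\<close>: \<^const>\<open>emeasure\<close> is \<open>0\<close> on sets that are not measurable.\<close>

lemma level_dim_ge_borel:
  fixes f :: "'a::metric_space \<Rightarrow> real"
  assumes F: "compact F" and f: "continuous_on F f"
  shows "{r. level_dim f r F \<ge> ereal d} \<in> sets borel"
proof -
  define N where "N q = {r. hausdorff_measure q {x \<in> F. f x = r} = 0}" for q
  have N: "N q \<in> sets borel" if "0 \<le> q" for q
  proof -
    define \<C> where "\<C> n = {U :: nat \<Rightarrow> 'a set. (\<forall>i. open (U i) \<and> bounded (U i) \<and> diameter (U i) \<le> 1 / Suc n)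
        \<and> (\<Sum>i. diam_power q (U i)) < ennreal (1 / Suc n)}" for n
    have "(\<exists>U\<in>delta_covers (1 / Suc n) A. (\<forall>i. open (U i)) \<and> (\<Sum>i. diam_power q (U i)) < ennreal (1 / Suc n))
        \<longleftrightarrow> (\<exists>U\<in>\<C> n. A \<subseteq> (\<Union>i. U i))" for n and A :: "'a set"
      unfolding \<C>_def delta_covers_def by (auto simp del: of_nat_Suc)
    then have "r \<in> N q \<longleftrightarrow> (\<forall>n. \<exists>U\<in>\<C> n. {x \<in> F. f x = r} \<subseteq> (\<Union>i. U i))" for r
      unfolding N_def mem_Collect_eq hausdorff_measure_eq_0_iff_open_covers[OF that] by presburger
    then have "N q = (\<Inter>n. \<Union>U\<in>\<C> n. {r. {x \<in> F. f x = r} \<subseteq> (\<Union>i. U i)})"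
      by (intro set_eqI) simp
    moreover have "open (\<Union>U\<in>\<C> n. {r. {x \<in> F. f x = r} \<subseteq> (\<Union>i. U i)})" for n
      by (intro open_UN ballI open_levels_covered[OF F f]) (auto simp: \<C>_def)
    ultimately show ?thesis by auto
  qed
  have "{r. level_dim f r F \<ge> ereal d} = UNIV - (\<Union>q\<in>{q\<in>\<rat>. 0 \<le> q \<and> q < d}. N q)"
    unfolding level_dim_def not_less[symmetric] hausdorff_dim_less_iff N_def by auto
  moreover have "countable {q\<in>\<rat>. 0 \<le> q \<and> q < d}"
    by (rule countable_subset[OF _ countable_rat]) auto
  ultimately show ?thesis using N by (auto intro!: sets.countable_UN')
qed

text \<open>A projection does not increase distances, so a cover of \<open>A\<close> by sets with small sum of diameters
  yields a cover of the projection by intervals of small total length.\<close>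

lemma hausdorff_dim_ge_1_if_projection_pos:
  fixes p :: "'a::metric_space \<Rightarrow> real"
  assumes p: "\<And>x y. \<bar>p x - p y\<bar> \<le> dist x y"
    and B: "B \<in> sets borel" "B \<subseteq> p ` A" "emeasure lborel B > 0"
  shows "hausdorff_dim A \<ge> 1"
proof (rule ccontr)
  assume "\<not> hausdorff_dim A \<ge> 1"
  then have "hausdorff_dim A < ereal 1" by (simp add: one_ereal_def not_le)
  then obtain q where "0 \<le> q" "q < 1" "hausdorff_measure q A = 0"
    unfolding hausdorff_dim_less_iff by auto
  then have H: "hausdorff_measure 1 A = 0" using hausdorff_measure_eq_0_mono[of q 1 A] by simp
  have "emeasure lborel B \<le> 0"
  proof (rule ennreal_le_epsilon)
    fix e :: real assume "0 < e"
    then have "0 < e / 2" by simp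
    then obtain U where U: "U \<in> delta_covers (e / 2) A" "(\<Sum>i. diam_power 1 (U i)) < ennreal (e / 2)"
      using H unfolding hausdorff_measure_eq_0_iff by metis
    define c where "c i = (SOME x. x \<in> U i)" for i
    define I where "I i = (if U i = {} then {} else cball (p (c i)) (diameter (U i)))" for i
    have c: "c i \<in> U i" if "U i \<noteq> {}" for i unfolding c_def using that by (auto intro: someI)
    have I: "p ` U i \<subseteq> I i" for i
    proof
      fix y assume "y \<in> p ` U i"
      then obtain x where x: "x \<in> U i" "y = p x" by auto
      then have "dist (c i) x \<le> diameter (U i)"
        using U(1) c[of i] by (intro diameter_bounded_bound) (auto simp: delta_covers_def)
      then have "\<bar>p (c i) - p x\<bar> \<le> diameter (U i)" using p[of "c i" x] by linarith
      then show "y \<in> I i" using x by (auto simp: I_def dist_real_def)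
    qed
    have "A \<subseteq> (\<Union>i. U i)" using U(1) by (simp add: delta_covers_def)
    have "B \<subseteq> (\<Union>i. I i)"
    proof
      fix y assume "y \<in> B"
      then obtain x where x: "x \<in> A" "y = p x" using B(2) by auto
      then obtain i where "x \<in> U i" using \<open>A \<subseteq> (\<Union>i. U i)\<close> by auto
      then have "y \<in> I i" using I[of i] x by auto
      then show "y \<in> (\<Union>i. I i)" by (rule UN_I[OF UNIV_I])
    qed
    then have "emeasure lborel B \<le> emeasure lborel (\<Union>i. I i)"
      by (rule emeasure_mono) (auto simp: I_def)
    also have "\<dots> \<le> (\<Sum>i. emeasure lborel (I i))"
      by (rule emeasure_subadditive_countably) (auto simp: I_def)
    \<comment> \<open>The interval around a point of \<open>p ` U i\<close> with the diameter of \<open>U i\<close> as radius has length twice that diameter.\<close>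
    also have "\<dots> \<le> (\<Sum>i. 2 * diam_power 1 (U i))"
    proof (intro suminf_le summableI)
      fix i
      have d: "0 \<le> diameter (U i)" using U(1) by (intro diameter_ge_0) (auto simp: delta_covers_def)
      have "emeasure lborel (cball (p (c i)) (diameter (U i))) = ennreal (2 * diameter (U i))"
        using d by (simp add: cball_eq_atLeastAtMost)
      then show "emeasure lborel (I i) \<le> 2 * diam_power 1 (U i)"
        using d by (auto simp: I_def diam_power_def ennreal_mult)
    qed
    also have "\<dots> = 2 * (\<Sum>i. diam_power 1 (U i))" by simp
    also have "\<dots> \<le> 2 * ennreal (e / 2)" using U(2) by (intro mult_left_mono) auto
    also have "\<dots> = ennreal e" using \<open>0 < e\<close>
      by (metis ennreal_mult' ennreal_numeral field_sum_of_halves mult_2 zero_le_numeral)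
    finally show "emeasure lborel B \<le> 0 + ennreal e" by simp
  qed
  with B(3) show False by simp
qed

section \<open>Complementary intervals of the fractal\<close>

definition grid :: "nat \<Rightarrow> real" where "grid k = (1/2) ^ (k^2)"
definition gap_len :: "nat \<Rightarrow> real" where "gap_len k = (1/2) ^ (k^3)"

lemma grid_pos [simp]: "0 < grid k" and gap_len_pos [simp]: "0 < gap_len k"
  by (auto simp: grid_def gap_len_def)

lemma grid_neq_0 [simp]: "grid k \<noteq> 0"
  using grid_pos[of k] by linarith

lemma gap_len_le_grid: "gap_len k \<le> grid k"
proof -
  have "k^2 \<le> k^3" by (cases "k = 0") (simp_all add: power_increasing del: power_increasing_iff)
  then show ?thesis unfolding grid_def gap_len_def by (rule power_decreasing) auto
qed

lemma gap_len_antimono: "k \<le> m \<Longrightarrow> gap_len m \<le> gap_len k"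
  unfolding gap_len_def by (intro power_decreasing power_mono) auto

lemma half_power_multiple: "a \<le> b \<Longrightarrow> (1/2::real) ^ a = 2 ^ (b - a) * (1/2) ^ b"
  by (simp add: power_divide power_diff)

lemma grid_refine: "k \<le> m \<Longrightarrow> grid k = 2 ^ (m^2 - k^2) * grid m"
  unfolding grid_def by (intro half_power_multiple power_mono) auto

lemma mem_gaps:
  "x \<in> gaps k \<longleftrightarrow> (\<exists>j::int. of_int j * grid k < x \<and> x < of_int j * grid k + gap_len k)"
  by (auto simp: gaps_def grid_def gap_len_def)

lemma grid_point_notin_gap:
  "of_int i * grid k \<notin> gaps k"
proof
  assume "of_int i * grid k \<in> gaps k"
  then obtain j :: int where j: "of_int j * grid k < of_int i * grid k"
    "of_int i * grid k < of_int j * grid k + gap_len k" by (auto simp: mem_gaps)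
  from j(1) have "j < i" by simp
  have "of_int i * grid k < (of_int j + 1) * grid k"
    using j(2) gap_len_le_grid[of k] by (simp add: algebra_simps)
  then have "real_of_int i < of_int j + 1" by simp
  with \<open>j < i\<close> show False by linarith
qed

lemma coarse_grid_point_notin_gap:
  assumes "m \<le> k"
  shows "of_int i * grid m \<notin> gaps k"
  using grid_point_notin_gap[of "i * 2 ^ (k^2 - m^2)" k] grid_refine[OF assms]
  by (simp add: mult.assoc)

text \<open>If \<open>k^3 \<le> m^2\<close>, the right end of a gap of level \<open>k\<close> lies on the grid of level \<open>m\<close>, and grid points are
  left ends of gaps. Otherwise that gap is shorter than the mesh of level \<open>m\<close> and starts at a grid point
  of level \<open>m\<close>, so the only gap of level \<open>m\<close> that could reach its right end starts at the same point,
  and it is not longer.\<close>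

lemma right_end_notin_gap:
  assumes "k \<le> m"
  shows "of_int j * grid k + gap_len k \<notin> gaps m"
proof (cases "k^3 \<le> m^2")
  case True
  have "of_int j * grid k + gap_len k = of_int (j * 2 ^ (m^2 - k^2) + 2 ^ (m^2 - k^3)) * grid m"
    using grid_refine[OF assms] half_power_multiple[OF True]
    by (simp add: grid_def gap_len_def algebra_simps)
  then show ?thesis using grid_point_notin_gap by metis
next
  case False
  then have less: "gap_len k < grid m"
    unfolding grid_def gap_len_def by (intro power_strict_decreasing) auto
  define j' where "j' = j * 2 ^ (m^2 - k^2)"
  have eq: "of_int j * grid k = of_int j' * grid m"
    using grid_refine[OF assms] by (simp add: j'_def)
  show ?thesis
  proof
    assume "of_int j * grid k + gap_len k \<in> gaps m"
    then obtain i :: int where i: "of_int i * grid m < of_int j' * grid m + gap_len k"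
      "of_int j' * grid m + gap_len k < of_int i * grid m + gap_len m"
      by (auto simp: mem_gaps eq)
    have "of_int i * grid m < (of_int j' + 1) * grid m"
      using i(1) less by (simp add: algebra_simps)
    then have "real_of_int i < of_int j' + 1" by simp
    moreover have "of_int j' * grid m < of_int i * grid m"
      using i(2) gap_len_antimono[OF assms] by linarith
    then have "j' < i" by simp
    ultimately show False by linarith
  qed
qed

lemma compact_F0: "compact F0"
proof -
  have "open (\<Union>k\<in>{2..}. gaps k)" unfolding gaps_def by (intro open_UN ballI open_greaterThanLessThan)
  then have "closed F0" unfolding F0_def by (intro closed_Diff) auto
  then show ?thesis
    by (metis F0_def Diff_subset bounded_closed_interval bounded_subset compact_eq_bounded_closed)
qed

text \<open>Gaps of different levels may be nested or adjacent. Among the gaps that meet the interval, one of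
  lowest level must fill it: by the preceding lemmas neither end of that gap lies in a gap of the same
  or a higher level, so an end inside the interval would belong to \<^const>\<open>F0\<close>.\<close>

lemma F0_complementary_interval:
  assumes "y \<in> F0" "z \<in> F0" "y < z" "{y<..<z} \<inter> F0 = {}"
  obtains k j where "2 \<le> k" "y = of_int j * grid k" "z = of_int j * grid k + gap_len k"
proof -
  define P where "P k \<longleftrightarrow> 2 \<le> k \<and> gaps k \<inter> {y<..<z} \<noteq> {}" for k
  have some: "\<exists>k. P k \<and> w \<in> gaps k" if "y < w" "w < z" for w
  proof -
    have "w \<notin> F0" "w \<in> {0..1/2}" using assms that by (auto simp: F0_def)
    then obtain k where "k \<ge> 2" "w \<in> gaps k" by (auto simp: F0_def)
    with that show ?thesis unfolding P_def by (intro exI[of _ k]) auto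
  qed
  define k where "k = (LEAST k. P k)"
  have "P k" unfolding k_def
    using some[of "(y + z)/2"] \<open>y < z\<close> by (auto intro: LeastI)
  have least: "k \<le> m" if "P m" for m unfolding k_def by (rule Least_le[of P, OF that])
  from \<open>P k\<close> obtain p j where p: "2 \<le> k" "y < p" "p < z"
     "of_int j * grid k < p" "p < of_int j * grid k + gap_len k"
    by (auto simp: P_def mem_gaps)
  have out: "x \<notin> F0" if "of_int j * grid k < x" "x < of_int j * grid k + gap_len k" for x
    using p(1) that by (auto simp: F0_def mem_gaps)
  have "\<not> y < of_int j * grid k"
    using some[of "of_int j * grid k"] least coarse_grid_point_notin_gap p by fastforce
  moreover have "\<not> of_int j * grid k + gap_len k < z"
    using some[of "of_int j * grid k + gap_len k"] least right_end_notin_gap p by fastforce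
  ultimately have "y = of_int j * grid k" "z = of_int j * grid k + gap_len k"
    using out[of y] out[of z] assms p by linarith+
  with p(1) show thesis by (rule that)
qed

section \<open>The fractal has positive length\<close>

text \<open>There are \<open>2 ^ (k^2 - 1)\<close> gaps of level \<open>k\<close> in \<open>[0, 1/2]\<close>. The bound is far from sharp; it is chosen
  so that its sum over \<open>k \<ge> 2\<close> is the geometric series with value \<open>1/8 < 1/2\<close>.\<close>

lemma emeasure_gaps_Int_le:
  assumes "2 \<le> k"
  shows "emeasure lborel ({0..1/2} \<inter> gaps k) \<le> ennreal ((1/2) ^ (k + 2))"
proof -
  define N where "N = (2::nat) ^ (k^2 - 1)"
  have k2: "1 \<le> k^2" using assms by (simp add: Suc_le_eq)
  have Ngrid: "real N * grid k = 1/2"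
    using k2 half_power_multiple[of 1 "k^2"] by (simp add: N_def grid_def)
  define I where "I i = {real i * grid k .. real i * grid k + gap_len k}" for i :: nat
  have "{0..1/2} \<inter> gaps k \<subseteq> (\<Union>i\<in>{..<N}. I i)"
  proof
    fix x assume "x \<in> {0..1/2} \<inter> gaps k"
    then obtain j :: int where x: "0 \<le> x" "x \<le> 1/2" and j: "of_int j * grid k < x" "x < of_int j * grid k + gap_len k"
      by (auto simp: mem_gaps)
    have "0 < (of_int j + 1) * grid k"
      using j x gap_len_le_grid[of k] by (simp add: algebra_simps)
    then have "0 < real_of_int j + 1" using grid_pos by (rule zero_less_mult_pos2)
    then have "0 \<le> j" by linarith
    then obtain i where i: "j = int i" by (rule nonneg_int_cases)
    have "of_int j * grid k < real N * grid k" using j x Ngrid by linarith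
    then have "i < N" by (simp add: i)
    then show "x \<in> (\<Union>i\<in>{..<N}. I i)"
      using j by (intro UN_I[of i]) (simp_all add: I_def i)
  qed
  then have "emeasure lborel ({0..1/2} \<inter> gaps k) \<le> emeasure lborel (\<Union>i\<in>{..<N}. I i)"
    by (rule emeasure_mono) (auto simp: I_def)
  also have "\<dots> \<le> (\<Sum>i<N. emeasure lborel (I i))"
    by (rule emeasure_subadditive_finite) (auto simp: I_def)
  also have "\<dots> = ennreal (real N * gap_len k)"
    by (simp add: I_def less_imp_le ennreal_mult' ennreal_of_nat_eq_real_of_nat)
  also have "real N * gap_len k \<le> (1/2) ^ (k + 2)"
  proof -
    have "(k^2 - 1) + (k + 2) \<le> k^3"
    proof -
      have "k^2 * 2 \<le> k^2 * k" using assms by (rule mult_left_mono) simp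
      moreover have "k * 2 \<le> k * k" using assms by (rule mult_left_mono) simp
      moreover have "k^2 * k = k^3" "k * k = k^2"
        by (simp_all add: power2_eq_square power3_eq_cube)
      ultimately show ?thesis using assms k2 by linarith
    qed
    then have "gap_len k \<le> (1/2) ^ ((k^2 - 1) + (k + 2))"
      unfolding gap_len_def by (rule power_decreasing) auto
    then have "real N * gap_len k \<le> real N * ((1/2) ^ (k^2 - 1) * (1/2) ^ (k + 2))"
      by (intro mult_left_mono) (simp_all add: power_add)
    also have "\<dots> = (1/2) ^ (k + 2)"
      by (simp add: N_def power_divide)
    finally show ?thesis .
  qed
  finally show ?thesis by (simp add: ennreal_leI)
qed

lemma F0_in_borel [measurable]: "F0 \<in> sets borel"
  using compact_F0 by (intro borel_closed compact_imp_closed)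

lemma emeasure_F0_pos: "emeasure lborel F0 > 0"
proof -
  define G where "G = (\<Union>k. {0..1/2} \<inter> gaps (k + 2))"
  have bor: "{0..1/2} \<inter> gaps k \<in> sets lborel" for k
  proof -
    have "open (gaps k)" unfolding gaps_def by (intro open_UN ballI open_greaterThanLessThan)
    then show ?thesis by auto
  qed
  have "emeasure lborel G \<le> (\<Sum>k. emeasure lborel ({0..1/2} \<inter> gaps (k + 2)))"
    unfolding G_def using bor by (intro emeasure_subadditive_countably) auto
  also have "\<dots> \<le> (\<Sum>k. ennreal ((1/2) ^ (k + 2 + 2)))"
    by (intro suminf_le summableI allI emeasure_gaps_Int_le) simp
  also have "\<dots> = ennreal (1/8)"
  proof (rule suminf_ennreal_eq)
    have "(\<lambda>k. (1/2::real) ^ k * (1/16)) sums (2 * (1/16))"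
      using geometric_sums[of "1/2::real"] by (intro sums_mult2) simp
    then show "(\<lambda>k. (1/2::real) ^ (k + 2 + 2)) sums (1/8)" by (simp add: power_add)
  qed auto
  finally have G: "emeasure lborel G \<le> ennreal (1/8)" .
  have "{0..1/2} \<subseteq> F0 \<union> G"
  proof
    fix x :: real assume x: "x \<in> {0..1/2}"
    show "x \<in> F0 \<union> G"
    proof (cases "x \<in> F0")
      case False
      then obtain k where "k \<ge> 2" "x \<in> gaps k" using x by (auto simp: F0_def)
      moreover from \<open>k \<ge> 2\<close> obtain l where "k = l + 2" by (metis add.commute le_Suc_ex)
      ultimately have "x \<in> {0..1/2} \<inter> gaps (l + 2)" using x by simp
      then show ?thesis unfolding G_def by blast
    qed simp
  qed
  moreover have Gs: "G \<in> sets lborel" unfolding G_def using bor by blast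
  ultimately have "emeasure lborel {0..1/2::real} \<le> emeasure lborel F0 + emeasure lborel G"
    by (intro order_trans[OF emeasure_mono emeasure_subadditive]) auto
  then have "ennreal (1/2) \<le> emeasure lborel F0 + emeasure lborel G" by simp
  also have "\<dots> \<le> emeasure lborel F0 + ennreal (1/8)" using G by (rule add_left_mono)
  finally have le: "ennreal (1/2) \<le> emeasure lborel F0 + ennreal (1/8)" .
  have "\<not> ennreal (1/2) \<le> ennreal (1/8)" by (subst ennreal_le_iff) auto
  with le have "emeasure lborel F0 \<noteq> 0" by (metis add_0)
  then show ?thesis by (simp add: zero_less_iff_neq_zero)
qed

section \<open>Values omitted at the gaps\<close>

text \<open>The density of gaps of level \<open>k\<close> is \<open>1 / grid k\<close>; this is therefore the total of the \<open>\<alpha>\<close>-th powers of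
  the lengths of these gaps, per unit length.\<close>

definition gap_ratio :: "real \<Rightarrow> nat \<Rightarrow> real" where
  "gap_ratio \<alpha> k = gap_len k powr \<alpha> / grid k"

lemma gap_ratio_nonneg [simp]: "0 \<le> gap_ratio \<alpha> k"
  by (simp add: gap_ratio_def less_imp_le)

lemma summable_gap_ratio:
  assumes "0 < \<alpha>"
  shows "summable (gap_ratio \<alpha>)"
proof (rule summable_comparison_test_ev)
  obtain K :: nat where K: "2 / \<alpha> < real K" using reals_Archimedean2 by blast
  have "norm (gap_ratio \<alpha> k) \<le> (1/2) ^ k" if "K \<le> k" for k
  proof -
    have "2 / \<alpha> < real k" using K that by linarith
    then have "2 \<le> \<alpha> * real k" using assms by (metis less_imp_le mult.commute pos_divide_le_eq)
    then have "real (k^2) * 2 \<le> real (k^2) * (\<alpha> * real k)" by (rule mult_left_mono) simp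
    moreover have "real (k^2) * (\<alpha> * real k) = \<alpha> * real (k^3)"
      by (simp add: power2_eq_square power3_eq_cube)
    moreover have "real k \<le> real (k^2)" by (simp only: of_nat_le_iff power2_nat_le_imp_le)
    ultimately have *: "real (k^2) - \<alpha> * real (k^3) \<le> - real k" by linarith
    have half: "(1/2::real) ^ n = 2 powr (- real n)" for n
      by (simp add: powr_minus powr_realpow power_one_over inverse_eq_divide)
    have "gap_ratio \<alpha> k = 2 powr (- real (k^3) * \<alpha> - (- real (k^2)))"
      unfolding gap_ratio_def gap_len_def grid_def half by (simp only: powr_powr powr_diff)
    also have "\<dots> \<le> 2 powr (- real k)"
      using * by (intro powr_mono) (simp_all add: mult.commute)
    finally show ?thesis unfolding half by simp
  qed
  then show "\<forall>\<^sub>F k in sequentially. norm (gap_ratio \<alpha> k) \<le> (1/2) ^ k"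
    unfolding eventually_sequentially by blast
  show "summable (\<lambda>k. (1/2::real) ^ k)" by (rule summable_geometric) simp
qed

definition gap_tail :: "real \<Rightarrow> nat \<Rightarrow> real" where
  "gap_tail \<alpha> n = (\<Sum>l. gap_ratio \<alpha> (l + n))"

lemma gap_tail_tendsto_0:
  assumes "0 < \<alpha>"
  shows "gap_tail \<alpha> \<longlonglongrightarrow> 0"
  unfolding gap_tail_def by (rule suminf_exist_split2[OF summable_gap_ratio[OF assms]])

lemma half_eq_grid_multiple: "2 \<le> k \<Longrightarrow> 1/2 = real_of_int (2 ^ (k^2 - 1)) * grid k"
  using half_power_multiple[of 1 "k^2"] by (simp add: grid_def Suc_le_eq)

lemma half_in_F0: "1/2 \<in> F0"
proof -
  have "1/2 \<notin> gaps k" if "2 \<le> k" for k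
    using half_eq_grid_multiple[OF that] grid_point_notin_gap by metis
  then show ?thesis by (auto simp: F0_def)
qed

text \<open>A coarser gap, of level \<open>k < n\<close>, occupies at most the left half of a cell of its grid, and the point lies
  in the right half of the last cell before \<open>1/2\<close>.\<close>

lemma half_minus_grid_in_F0:
  assumes "2 \<le> n"
  shows "1/2 - grid n \<in> F0"
proof -
  have "1/2 - grid n \<notin> gaps k" if "2 \<le> k" for k
  proof (cases "n \<le> k")
    case True
    have "1/2 - grid n = of_int (2 ^ (n^2 - 1) - 1) * grid n"
      by (subst half_eq_grid_multiple[OF assms]) (simp add: algebra_simps)
    then show ?thesis using coarse_grid_point_notin_gap[OF True] by metis
  next
    case False
    then have kn: "k < n" by simp
    have g2: "2 * grid n \<le> grid k"
    proof -
      have "k^2 < n^2" using kn by (simp add: power_strict_mono)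
      then have "Suc (k^2) \<le> n^2" by simp
      then have "grid n \<le> (1/2) ^ Suc (k^2)" unfolding grid_def by (rule power_decreasing) auto
      then show ?thesis by (simp add: grid_def)
    qed
    have l2: "2 * gap_len k \<le> grid k"
    proof -
      have "k^2 < k^3" using that by (intro power_strict_increasing) auto
      then have "Suc (k^2) \<le> k^3" by (rule Suc_leI)
      then have "gap_len k \<le> (1/2) ^ Suc (k^2)" unfolding gap_len_def by (rule power_decreasing) auto
      then show ?thesis by (simp add: grid_def)
    qed
    show ?thesis
    proof
      assume "1/2 - grid n \<in> gaps k"
      then obtain j :: int where j: "of_int j * grid k < 1/2 - grid n" "1/2 - grid n < of_int j * grid k + gap_len k"
        by (auto simp: mem_gaps)
      define c :: int where "c = 2 ^ (k^2 - 1)"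
      have c: "1/2 = of_int c * grid k" using half_eq_grid_multiple[OF that] by (simp add: c_def)
      have "of_int j * grid k < of_int c * grid k" using j(1) c grid_pos[of n] by linarith
      then have "j < c" by simp
      have "of_int c * grid k < (of_int j + 1) * grid k"
        using j(2) c g2 l2 by (simp add: algebra_simps)
      then have "real_of_int c < of_int j + 1" by simp
      with \<open>j < c\<close> show False by linarith
    qed
  qed
  moreover have "grid n \<le> 1/2"
  proof -
    have "1 \<le> n^2" using assms by (simp add: Suc_le_eq)
    then have "grid n \<le> (1/2)^1" unfolding grid_def by (rule power_decreasing) auto
    then show ?thesis by simp
  qed
  ultimately show ?thesis by (auto simp: F0_def less_imp_le)
qed

text \<open>A gap of level \<open>k < n\<close> that ends before \<open>1/2\<close> starts at least \<open>grid k\<close> before \<open>1/2\<close>, which is outside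
  the window.\<close>

lemma gaps_in_window:
  assumes n: "2 \<le> n" and k: "2 \<le> k"
    and u: "1/2 - grid n \<le> of_int j * grid k" and v: "of_int j * grid k + gap_len k \<le> 1/2"
  shows "n \<le> k \<and> (\<exists>i\<in>{1..2 ^ (k^2 - n^2)}. of_int j * grid k = 1/2 - real i * grid k)"
proof -
  define c :: int where "c = 2 ^ (k^2 - 1)"
  have c: "1/2 = of_int c * grid k"
    using half_eq_grid_multiple[OF k] by (simp add: c_def)
  have "of_int j * grid k < of_int c * grid k" using v c gap_len_pos[of k] by linarith
  then have jc: "j < c" by simp
  then have "(of_int j + 1) * grid k \<le> of_int c * grid k" 
    by (intro mult_right_mono) (auto simp: less_imp_le)
  then have "grid k \<le> grid n" using u c by (simp add: algebra_simps)
  then have "n^2 \<le> k^2" unfolding grid_def by (simp add: power_decreasing_iff)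
  then have nk: "n \<le> k" by (simp add: power2_nat_le_eq_le)
  have gn: "grid n = of_int (2 ^ (k^2 - n^2)) * grid k" using grid_refine[OF nk] by simp
  have "of_int (c - j) * grid k \<le> of_int (2 ^ (k^2 - n^2)) * grid k"
    using u c gn by (simp add: algebra_simps)
  then have "c - j \<le> 2 ^ (k^2 - n^2)"
    by (metis grid_pos mult_le_cancel_right_pos of_int_le_iff)
  then have "nat (c - j) \<in> {1..2 ^ (k^2 - n^2)}" using jc
    by (auto simp: nat_le_iff)
  moreover have "of_int j * grid k = 1/2 - real (nat (c - j)) * grid k"
    using jc c by (simp add: algebra_simps)
  ultimately show ?thesis using nk by blast
qed

text \<open>Let \<open>u\<close> be the last point of \<open>K\<close> with value at most \<open>r\<close>, and \<open>v\<close> the first point after \<open>u\<close> with value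
  at least \<open>r\<close>. Every point of \<open>K\<close> has one of these two properties, so none lies between.\<close>

lemma compact_ivt_or_gap_less:
  fixes g :: "real \<Rightarrow> real"
  assumes K: "compact K" and g: "continuous_on K g" and ab: "a \<in> K" "b \<in> K" "a < b"
    and r: "g a < r" "r < g b" "r \<notin> g ` (K \<inter> {a..b})"
  shows "\<exists>u v. u \<in> K \<and> v \<in> K \<and> a \<le> u \<and> u < v \<and> v \<le> b \<and> {u<..<v} \<inter> K = {} \<and> g u < r \<and> r < g v"
proof -
  let ?C = "K \<inter> {a..b}"
  have C: "compact ?C" using K by (intro compact_Int) auto
  have gC: "continuous_on ?C g" using g by (rule continuous_on_subset) auto
  define L where "L = ?C \<inter> g -` {..r}"
  have "closed L" unfolding L_def
    by (rule continuous_closed_preimage[OF gC compact_imp_closed[OF C] closed_atMost])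
  then have "compact (?C \<inter> L)" by (rule compact_Int_closed[OF C])
  moreover have "?C \<inter> L = L" by (auto simp: L_def)
  ultimately have L: "compact L" by simp
  have "a \<in> L" using ab r by (auto simp: L_def)
  then obtain u where u: "u \<in> L" "\<And>x. x \<in> L \<Longrightarrow> x \<le> u"
    using compact_attains_sup[OF L] by auto
  define R where "R = ?C \<inter> {u..} \<inter> g -` {r..}"
  have "closed (?C \<inter> g -` {r..})"
    by (rule continuous_closed_preimage[OF gC compact_imp_closed[OF C] closed_atLeast])
  then have "compact (?C \<inter> ((?C \<inter> g -` {r..}) \<inter> {u..}))"
    by (rule compact_Int_closed[OF C closed_Int[OF _ closed_atLeast]])
  moreover have "?C \<inter> ((?C \<inter> g -` {r..}) \<inter> {u..}) = R" by (auto simp: R_def)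
  ultimately have R: "compact R" by simp
  have "u \<le> b" using u by (auto simp: L_def)
  have "b \<in> R" using ab r u by (auto simp: R_def L_def)
  then obtain v where v: "v \<in> R" "\<And>x. x \<in> R \<Longrightarrow> v \<le> x"
    using compact_attains_inf[OF R] by auto
  have gu: "g u < r" using u r by (force simp: L_def)
  have gv: "r < g v" using v r by (force simp: R_def)
  have "u < v" using gu gv v(1) by (cases "u = v") (auto simp: R_def)
  moreover have "{u<..<v} \<inter> K = {}"
  proof -
    have False if "w \<in> K" "u < w" "w < v" for w
    proof (cases "g w \<le> r")
      case True
      then have "w \<in> L" using that u(1) v(1) by (auto simp: L_def R_def)
      then show False using u(2) that by fastforce
    next
      case False
      then have "w \<in> R" using that u(1) v(1) by (auto simp: L_def R_def)
      then show False using v(2) that by fastforce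
    qed
    then show ?thesis by auto
  qed
  ultimately show ?thesis using gu gv u(1) v(1)
    by (intro exI[of _ u] exI[of _ v]) (auto simp: L_def R_def)
qed

lemma compact_ivt_or_gap:
  fixes g :: "real \<Rightarrow> real"
  assumes K: "compact K" and g: "continuous_on K g" and ab: "a \<in> K" "b \<in> K" "a < b"
    and r: "r \<in> closed_segment (g a) (g b)" "r \<notin> g ` (K \<inter> {a..b})"
  shows "\<exists>u v. u \<in> K \<and> v \<in> K \<and> a \<le> u \<and> u < v \<and> v \<le> b \<and> {u<..<v} \<inter> K = {}
           \<and> r \<in> closed_segment (g u) (g v)"
proof -
  have ne: "r \<noteq> g a" "r \<noteq> g b" using r(2) ab by auto
  consider "g a < r" "r < g b" | "- g a < - r" "- r < - g b"
    using r(1) ne by (auto simp: closed_segment_eq_real_ivl split: if_splits)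
  then show ?thesis
  proof cases
    case 1
    from compact_ivt_or_gap_less[OF K g ab 1 r(2)]
    show ?thesis by (force simp: closed_segment_eq_real_ivl)
  next
    case 2
    have "- r \<notin> (\<lambda>x. - g x) ` (K \<inter> {a..b})" using r(2) by auto
    from compact_ivt_or_gap_less[OF K continuous_on_minus[OF g] ab 2 this]
    show ?thesis by (force simp: closed_segment_eq_real_ivl)
  qed
qed

lemma continuous_on_holder:
  fixes f :: "'a::metric_space \<Rightarrow> real"
  assumes "0 < \<alpha>" "\<And>x y. x \<in> K \<Longrightarrow> y \<in> K \<Longrightarrow> \<bar>f x - f y\<bar> \<le> dist x y powr \<alpha>"
  shows "continuous_on K f"
  unfolding continuous_on_iff
proof (intro ballI allI impI)
  fix x e assume x: "x \<in> K" and "0 < (e::real)"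
  have "dist (f y) (f x) < e" if "y \<in> K" "dist y x < e powr (1/\<alpha>)" for y
  proof -
    have "dist (f y) (f x) \<le> dist y x powr \<alpha>" using assms(2) x that by (simp add: dist_real_def)
    also have "\<dots> < (e powr (1/\<alpha>)) powr \<alpha>" using that assms(1) by (intro powr_less_mono2) auto
    also have "\<dots> = e" using assms(1) \<open>0 < e\<close> by (simp add: powr_powr)
    finally show ?thesis .
  qed
  then show "\<exists>d>0. \<forall>y\<in>K. dist y x < d \<longrightarrow> dist (f y) (f x) < e"
    using \<open>0 < e\<close> by (intro exI[of _ "e powr (1/\<alpha>)"]) auto
qed

lemma continuous_on_holder_function:
  assumes "f \<in> holder_functions \<alpha> F" "0 < \<alpha>"
  shows "continuous_on F f"
  using assms by (intro continuous_on_holder[of \<alpha>]) (auto simp: holder_functions_def)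

lemma emeasure_closed_segment_real:
  "emeasure lborel (closed_segment a (b::real)) = ennreal \<bar>a - b\<bar>"
  by (auto simp: closed_segment_eq_real_ivl)

lemma closed_segment_borel [measurable]: "closed_segment a (b::real) \<in> sets borel"
  by (auto simp: closed_segment_eq_real_ivl)

text \<open>By \<open>compact_ivt_or_gap\<close>, a value between the end values that is not attained lies in the segment
  between the values at the two ends of a gap. These segments have length at most the \<open>\<alpha>\<close>-th power of the
  gap length, and their lengths are summed over all gaps in the window.\<close>

lemma emeasure_range_window:
  assumes \<alpha>: "0 < \<alpha>" and n: "2 \<le> n"
    and g: "\<And>x y. x \<in> F0 \<Longrightarrow> y \<in> F0 \<Longrightarrow> \<bar>g x - g y\<bar> \<le> \<bar>x - y\<bar> powr \<alpha>"
  shows "ennreal \<bar>g (1/2 - grid n) - g (1/2)\<bar> \<le>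
         emeasure lborel (g ` (F0 \<inter> {1/2 - grid n..1/2})) + ennreal (grid n * gap_tail \<alpha> n)"
proof -
  let ?a = "1/2 - grid n" and ?K = "F0 \<inter> {1/2 - grid n..1/2}"
  \<comment> \<open>For an index that does not belong to a gap with ends in \<^const>\<open>F0\<close>, the Hoelder condition gives no bound; such indices get the empty set.\<close>
  define T where "T k i = (let u = 1/2 - real i * grid k; v = u + gap_len k in
      if u \<in> F0 \<and> v \<in> F0 then closed_segment (g u) (g v) else {})" for k and i :: nat
  define B where "B l = (\<Union>i\<in>{1..2 ^ ((l+n)^2 - n^2)}. T (l + n) i)" for l
  have cont: "continuous_on F0 g"
    using \<alpha> g by (intro continuous_on_holder[of \<alpha>]) (auto simp: dist_real_def)
  have comp: "compact (g ` ?K)"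
    using compact_F0 cont by (intro compact_continuous_image compact_Int_closed)
      (auto intro: continuous_on_subset)
  then have gK [measurable]: "g ` ?K \<in> sets borel" by (intro borel_closed compact_imp_closed)
  have T_meas [measurable]: "T k i \<in> sets borel" for k i by (simp add: T_def Let_def)
  then have B_meas [measurable]: "B l \<in> sets borel" for l unfolding B_def by measurable
  have cover: "closed_segment (g ?a) (g (1/2)) \<subseteq> g ` ?K \<union> (\<Union>l. B l)"
  proof
    fix r assume r: "r \<in> closed_segment (g ?a) (g (1/2))"
    show "r \<in> g ` ?K \<union> (\<Union>l. B l)"
    proof (cases "r \<in> g ` ?K")
      case False
      from compact_ivt_or_gap[OF compact_F0 cont half_minus_grid_in_F0[OF n] half_in_F0 _ r False]
      obtain u v where uv: "u \<in> F0" "v \<in> F0" "?a \<le> u" "u < v" "v \<le> 1/2"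
        "{u<..<v} \<inter> F0 = {}" "r \<in> closed_segment (g u) (g v)" by auto
      from F0_complementary_interval[OF uv(1,2,4,6)] obtain k j
        where kj: "2 \<le> k" "u = of_int j * grid k" "v = of_int j * grid k + gap_len k" by metis
      from gaps_in_window[OF n kj(1), of j] uv kj obtain i
        where i: "n \<le> k" "i \<in> {1..2 ^ (k^2 - n^2)}" "u = 1/2 - real i * grid k" by auto
      have "r \<in> T k i" unfolding T_def Let_def using uv kj i by auto
      then have "r \<in> B (k - n)" unfolding B_def using i by auto
      then show ?thesis by blast
    qed simp
  qed
  have T_le: "emeasure lborel (T k i) \<le> ennreal (gap_len k powr \<alpha>)" for k i
    using g[of "1/2 - real i * grid k" "1/2 - real i * grid k + gap_len k"]
    by (auto simp: T_def Let_def emeasure_closed_segment_real ennreal_leI less_imp_le)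
  have B_le: "emeasure lborel (B l) \<le> ennreal (grid n * gap_ratio \<alpha> (l + n))" for l
  proof -
    define N where "N = (2::nat) ^ ((l+n)^2 - n^2)"
    have "emeasure lborel (B l) \<le> (\<Sum>i=1..N. emeasure lborel (T (l + n) i))"
      unfolding B_def N_def by (rule emeasure_subadditive_finite) auto
    also have "\<dots> \<le> (\<Sum>i=1..N. ennreal (gap_len (l + n) powr \<alpha>))"
      by (intro sum_mono T_le)
    also have "\<dots> = ennreal (real N * gap_len (l + n) powr \<alpha>)"
      by (simp add: ennreal_mult' ennreal_of_nat_eq_real_of_nat)
    also have "real N * gap_len (l + n) powr \<alpha> = grid n * gap_ratio \<alpha> (l + n)"
      using grid_refine[of n "l + n"] grid_pos[of "l+n"]
      by (simp add: N_def gap_ratio_def)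
    finally show ?thesis .
  qed
  have sm: "summable (\<lambda>l. gap_ratio \<alpha> (l + n))"
    using summable_gap_ratio[OF \<alpha>] by (rule summable_ignore_initial_segment)
  have "emeasure lborel (\<Union>l. B l) \<le> (\<Sum>l. emeasure lborel (B l))"
    by (rule emeasure_subadditive_countably) auto
  also have "\<dots> \<le> (\<Sum>l. ennreal (grid n * gap_ratio \<alpha> (l + n)))"
    using B_le by (intro suminf_le summableI allI)
  also have "\<dots> = ennreal (grid n * gap_tail \<alpha> n)"
    unfolding gap_tail_def using sm
    by (intro suminf_ennreal_eq sums_mult summable_sums) (auto simp: less_imp_le)
  finally have UB: "emeasure lborel (\<Union>l. B l) \<le> ennreal (grid n * gap_tail \<alpha> n)" .
  have "ennreal \<bar>g ?a - g (1/2)\<bar> = emeasure lborel (closed_segment (g ?a) (g (1/2)))"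
    by (simp add: emeasure_closed_segment_real)
  also have "\<dots> \<le> emeasure lborel (g ` ?K \<union> (\<Union>l. B l))"
    using cover by (rule emeasure_mono) auto
  also have "\<dots> \<le> emeasure lborel (g ` ?K) + emeasure lborel (\<Union>l. B l)"
    by (rule emeasure_subadditive) auto
  also have "\<dots> \<le> emeasure lborel (g ` ?K) + ennreal (grid n * gap_tail \<alpha> n)"
    using UB by (rule add_left_mono)
  finally show ?thesis .
qed

section \<open>The space of Hoelder functions\<close>

locale holder_setting =
  fixes \<alpha> :: real and F :: "'a::metric_space set"
  assumes alpha_pos: "0 < \<alpha>" and bounded_F: "bounded F" and F_nonempty: "F \<noteq> {}"
begin

abbreviation H where "H \<equiv> holder_functions \<alpha> F"
abbreviation T where "T \<equiv> mtopology_of (holder_space \<alpha> F)"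

lemma mspace_eq: "mspace (holder_space \<alpha> F) = H"
  using mspace_holder_space[OF bounded_F alpha_pos] .

lemma mdist_le_iff:
  assumes "f \<in> H" "g \<in> H"
  shows "mdist (holder_space \<alpha> F) f g \<le> e \<longleftrightarrow> (\<forall>x\<in>F. \<bar>f x - g x\<bar> \<le> e)"
proof -
  have "f \<in> mspace (holder_space \<alpha> F)" "g \<in> mspace (holder_space \<alpha> F)"
    using assms by (simp_all add: mspace_eq)
  then have "f \<in> mspace (funspace F euclidean_metric)" "g \<in> mspace (funspace F (euclidean_metric :: real metric))"
    by (simp_all add: holder_space_def)
  then have "mdist (funspace F euclidean_metric) f g \<le> e \<longleftrightarrow> (\<forall>x\<in>F. mdist euclidean_metric (f x) (g x) \<le> e)"
    by (rule funspace_mdist_le[OF _ _ F_nonempty])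
  then show ?thesis by (simp add: holder_space_def dist_real_def)
qed

interpretation HS: Metric_space H "mdist (holder_space \<alpha> F)"
  rewrites "HS.mtopology = T"
  using Metric_space_mspace_mdist[of "holder_space \<alpha> F"] by (simp_all add: mspace_eq mtopology_of_def)

lemma openin_holderI:
  assumes "U \<subseteq> H"
    and "\<And>f. f \<in> U \<Longrightarrow> \<exists>e>0. \<forall>g\<in>H. (\<forall>x\<in>F. \<bar>f x - g x\<bar> \<le> e) \<longrightarrow> g \<in> U"
  shows "openin T U"
  unfolding HS.openin_mtopology_mcball
proof (intro conjI allI impI)
  fix f assume f: "f \<in> U"
  then obtain e where "e > 0" "\<forall>g\<in>H. (\<forall>x\<in>F. \<bar>f x - g x\<bar> \<le> e) \<longrightarrow> g \<in> U" using assms(2) by blast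
  then show "\<exists>r>0. HS.mcball f r \<subseteq> U"
    using f assms(1) by (intro exI[of _ e]) (auto simp: mdist_le_iff)
qed (fact assms(1))

lemma dense_holder_iff:
  assumes "U \<subseteq> H"
  shows "T closure_of U = H \<longleftrightarrow> (\<forall>f\<in>H. \<forall>e>0. \<exists>g\<in>U. \<forall>x\<in>F. \<bar>f x - g x\<bar> \<le> e)"
proof -
  have "y \<in> HS.mcball f r \<longleftrightarrow> (\<forall>x\<in>F. \<bar>f x - y x\<bar> \<le> r)" if "f \<in> H" "y \<in> U" for f y r
    using that assms by (auto simp: mdist_le_iff)
  then have "T closure_of U = {f \<in> H. \<forall>r>0. \<exists>y\<in>U. \<forall>x\<in>F. \<bar>f x - y x\<bar> \<le> r}"
    unfolding HS.metric_closure_of_alt by (metis (no_types, lifting))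
  then show ?thesis by blast
qed

text \<open>The Hoelder condition passes to uniform limits, so the space is closed in the complete space of
  bounded functions.\<close>

lemma mcomplete_holder: "HS.mcomplete"
proof -
  let ?m = "funspace F (euclidean_metric :: real metric)"
  have sub: "H \<subseteq> mspace ?m" using mspace_eq unfolding holder_space_def by auto
  interpret FS: Submetric "mspace ?m" "mdist ?m" H
    by (intro Submetric.intro Submetric_axioms.intro Metric_space_mspace_mdist sub)
  have eq: "mdist ?m = mdist (holder_space \<alpha> F)" by (simp add: holder_space_def)
  have real_complete: "Metric_space.mcomplete (UNIV :: real set) dist"
    using complete_UNIV[where 'a = real] by (simp only: mcomplete_iff_complete)
  have fs: "FS.mcomplete"
    using Metric_space.mcomplete_funspace[OF Met_TC.Metric_space_axioms real_complete, of F]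
    by (simp add: mcomplete_of_def)
  have "Metric_space.mcomplete H (mdist ?m)"
  proof (rule FS.sequentially_closedin_mcomplete_imp_mcomplete[OF fs])
    fix \<sigma> l assume "range \<sigma> \<subseteq> H \<and> limitin FS.mtopology \<sigma> l sequentially"
    then have \<sigma>: "range \<sigma> \<subseteq> H" and lim: "limitin FS.mtopology \<sigma> l sequentially" by auto
    have l: "l \<in> mspace ?m" using lim by (simp add: FS.limitin_metric del: mspace_funspace mdist_funspace)
    have "\<bar>l x - l y\<bar> \<le> dist x y powr \<alpha>" if "x \<in> F" "y \<in> F" for x y
    proof (rule field_le_epsilon)
      fix e :: real assume "0 < e"
      then have "0 < e / 2" by simp
      then have "eventually (\<lambda>n. \<sigma> n \<in> mspace ?m \<and> mdist ?m (\<sigma> n) l < e / 2) sequentially"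
        using lim unfolding FS.limitin_metric by blast
      from eventually_happens'[OF sequentially_bot this]
      obtain n where n: "mdist ?m (\<sigma> n) l \<le> e / 2"
        using less_imp_le by blast
      have \<sigma>n: "\<sigma> n \<in> H" using \<sigma> by auto
      then have "\<sigma> n \<in> mspace ?m" using sub by blast
      then have "\<forall>x\<in>F. mdist euclidean_metric (\<sigma> n x) (l x) \<le> e / 2"
        using funspace_mdist_le[OF _ l F_nonempty] n by blast
      then have "\<bar>\<sigma> n x - l x\<bar> \<le> e / 2" "\<bar>\<sigma> n y - l y\<bar> \<le> e / 2"
        using that by (auto simp: dist_real_def)
      moreover have "\<bar>\<sigma> n x - \<sigma> n y\<bar> \<le> dist x y powr \<alpha>"
        using \<sigma>n that by (simp add: holder_functions_def)
      ultimately show "\<bar>l x - l y\<bar> \<le> dist x y powr \<alpha> + e" by linarith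
    qed
    moreover have "l \<in> extensional F" using l by (rule funspace_imp_extensional)
    ultimately show "l \<in> H" by (simp add: holder_functions_def)
  qed
  then show ?thesis by (simp add: eq del: mdist_funspace)
qed

text \<open>The given dense \<open>G\<^sub>\<delta>\<close> set is itself a countable intersection of sets that are open and dense, so Baire's
  theorem applies to these together with the sets \<open>V n\<close>.\<close>

lemma dense_gdelta_meets_residual:
  assumes G: "\<G> \<in> dense_gdelta_sets \<alpha> F"
    and V: "\<And>n::nat. openin T (V n)" "\<And>n. T closure_of (V n) = H"
  shows "\<exists>f\<in>\<G>. \<forall>n. f \<in> V n"
proof -
  have g: "gdelta_in T \<G>" "T closure_of \<G> = H"
    using G by (auto simp: dense_gdelta_sets_def mspace_eq)
  from g(1) obtain C where C: "\<And>n::nat. openin T (C n)" "\<Inter>(range C) = \<G>"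
    unfolding gdelta_in_descending by blast
  have Cd: "T closure_of (C n) = H" for n
  proof -
    have "H \<subseteq> T closure_of (C n)" using g(2) C(2) closure_of_mono[of \<G> "C n" T] by auto
    then show ?thesis using closure_of_subset_topspace[of T "C n"] by (simp add: mspace_eq)
  qed
  have "T closure_of \<Inter>(range C \<union> range V) = H"
    by (rule HS.metric_Baire_category[OF mcomplete_holder]) (use C V Cd in auto)
  moreover have "H \<noteq> {}"
  proof -
    have "restrict (\<lambda>_. 0) F \<in> H" by (auto simp: holder_functions_def)
    then show ?thesis by blast
  qed
  ultimately have "\<Inter>(range C \<union> range V) \<noteq> {}" by (metis closure_of_empty)
  then show ?thesis using C(2) by blast
qed

end

lemma compact_F_square: "compact F_square"
  unfolding F_square_def using compact_F0 by (intro compact_Times)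

lemma F0_bounds: "x \<in> F0 \<Longrightarrow> 0 \<le> x \<and> x \<le> 1/2"
  by (simp add: F0_def)

lemma dist_F_square_le_1:
  assumes "p \<in> F_square" "q \<in> F_square"
  shows "dist p q \<le> 1"
proof -
  have "fst p \<in> F0" "snd p \<in> F0" "fst q \<in> F0" "snd q \<in> F0"
    using assms by (auto simp: F_square_def)
  then have "\<bar>fst p - fst q\<bar> + \<bar>snd p - snd q\<bar> \<le> 1"
    using F0_bounds by (smt (verit) field_sum_of_halves)
  moreover have "dist p q \<le> \<bar>fst p - fst q\<bar> + \<bar>snd p - snd q\<bar>"
    unfolding dist_prod_def dist_real_def by (rule order_trans[OF sqrt_sum_squares_le_sum_abs]) simp
  ultimately show ?thesis by linarith
qed

lemma holder_setting_F_square: "0 < \<alpha> \<Longrightarrow> holder_setting \<alpha> F_square"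
  using compact_F_square half_in_F0 
  by (auto simp: holder_setting_def compact_imp_bounded F_square_def)

section \<open>Generic level sets have dimension at least one\<close>

lemma le_powr_of_le_1:
  fixes t :: real
  assumes "0 \<le> t" "t \<le> 1" "0 < \<alpha>" "\<alpha> \<le> 1"
  shows "t \<le> t powr \<alpha>"
  using powr_mono'[of \<alpha> 1 t] assms by (cases "t = 0") auto

definition window_osc :: "(real \<times> real \<Rightarrow> real) \<Rightarrow> nat \<Rightarrow> real \<Rightarrow> real" where
  "window_osc f n x = \<bar>f (x, 1/2 - grid n) - f (x, 1/2)\<bar>"

definition osc_set :: "real \<Rightarrow> (real \<times> real \<Rightarrow> real) \<Rightarrow> nat \<Rightarrow> real \<Rightarrow> real set" where
  "osc_set \<alpha> f n \<eta> = {x \<in> F0. grid n * gap_tail \<alpha> n + \<eta> \<le> window_osc f n x}"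

text \<open>The margin \<open>\<eta>\<close> is what makes this condition stable under uniformly small perturbations.\<close>

definition oscillating :: "real \<Rightarrow> (real \<times> real \<Rightarrow> real) set" where
  "oscillating \<alpha> = {f \<in> holder_functions \<alpha> F_square.
     \<exists>n\<ge>2. \<exists>\<eta>>0. 0 < emeasure lborel (osc_set \<alpha> f n \<eta>)}"

lemma compact_osc_set:
  assumes "0 < \<alpha>" "f \<in> holder_functions \<alpha> F_square" "2 \<le> n"
  shows "compact (osc_set \<alpha> f n \<eta>)"
proof -
  have c: "continuous_on F_square f" using assms by (intro continuous_on_holder_function)
  have "continuous_on F0 (\<lambda>x. f (x, y))" if "y \<in> F0" for y
    using that by (intro continuous_on_compose2[OF c] continuous_intros) (auto simp: F_square_def)
  then have "continuous_on F0 (window_osc f n)"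
    unfolding window_osc_def using half_in_F0 half_minus_grid_in_F0[OF assms(3)]
    by (intro continuous_intros) auto
  then have "closed (F0 \<inter> window_osc f n -` {grid n * gap_tail \<alpha> n + \<eta>..})"
    by (rule continuous_closed_preimage[OF _ compact_imp_closed[OF compact_F0] closed_atLeast])
  then have "compact (F0 \<inter> (F0 \<inter> window_osc f n -` {grid n * gap_tail \<alpha> n + \<eta>..}))"
    by (rule compact_Int_closed[OF compact_F0])
  moreover have "F0 \<inter> (F0 \<inter> window_osc f n -` {grid n * gap_tail \<alpha> n + \<eta>..}) = osc_set \<alpha> f n \<eta>"
    by (auto simp: osc_set_def)
  ultimately show ?thesis by simp
qed

lemma openin_oscillating:
  assumes "0 < \<alpha>"
  shows "openin (mtopology_of (holder_space \<alpha> F_square)) (oscillating \<alpha>)"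
proof -
  interpret holder_setting \<alpha> F_square by (rule holder_setting_F_square[OF assms])
  show ?thesis
  proof (rule openin_holderI)
    show "oscillating \<alpha> \<subseteq> H" by (auto simp: oscillating_def)
    fix f assume "f \<in> oscillating \<alpha>"
    then obtain n \<eta> where n: "2 \<le> n" and \<eta>: "0 < \<eta>" "0 < emeasure lborel (osc_set \<alpha> f n \<eta>)" and f: "f \<in> H"
      unfolding oscillating_def by auto
    have "g \<in> oscillating \<alpha>" if g: "g \<in> H" and near: "\<forall>p\<in>F_square. \<bar>f p - g p\<bar> \<le> \<eta>/4" for g
    proof -
      have "osc_set \<alpha> f n \<eta> \<subseteq> osc_set \<alpha> g n (\<eta>/2)"
      proof
        fix x assume x: "x \<in> osc_set \<alpha> f n \<eta>"
        then have "x \<in> F0" by (simp add: osc_set_def)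
        then have "\<bar>f (x, 1/2 - grid n) - g (x, 1/2 - grid n)\<bar> \<le> \<eta>/4" "\<bar>f (x, 1/2) - g (x, 1/2)\<bar> \<le> \<eta>/4"
          using near half_in_F0 half_minus_grid_in_F0[OF n] by (auto simp: F_square_def)
        then have "window_osc f n x \<le> window_osc g n x + \<eta>/2"
          unfolding window_osc_def by linarith
        then show "x \<in> osc_set \<alpha> g n (\<eta>/2)" using x by (simp add: osc_set_def)
      qed
      moreover have "osc_set \<alpha> g n (\<eta>/2) \<in> sets lborel"
        using compact_osc_set[OF assms g n] by (simp add: borel_closed compact_imp_closed)
      ultimately have "emeasure lborel (osc_set \<alpha> f n \<eta>) \<le> emeasure lborel (osc_set \<alpha> g n (\<eta>/2))"
        by (rule emeasure_mono)
      then have "0 < emeasure lborel (osc_set \<alpha> g n (\<eta>/2))" using \<eta>(2) by (rule less_le_trans[rotated])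
      moreover have "0 < \<eta>/2" using \<eta> by simp
      ultimately show ?thesis using g n unfolding oscillating_def by blast
    qed
    then show "\<exists>e>0. \<forall>g\<in>H. (\<forall>x\<in>F_square. \<bar>f x - g x\<bar> \<le> e) \<longrightarrow> g \<in> oscillating \<alpha>"
      using \<eta>(1) by (intro exI[of _ "\<eta>/4"]) auto
  qed
qed

text \<open>A convex combination with the coordinate \<open>y\<close>, which is itself \<open>1\<close>-Hoelder-\<open>\<alpha>\<close> since distances in the
  fractal are at most \<open>1\<close>. A convex combination preserves the Hoelder constant; a sum would not.\<close>

definition tilt :: "real \<Rightarrow> (real \<times> real \<Rightarrow> real) \<Rightarrow> real \<times> real \<Rightarrow> real" where
  "tilt \<epsilon> f = restrict (\<lambda>p. (1 - \<epsilon>) * f p + \<epsilon> * snd p) F_square"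

lemma tilt_holder:
  assumes "0 < \<alpha>" "\<alpha> \<le> 1" "f \<in> holder_functions \<alpha> F_square" "0 \<le> \<epsilon>" "\<epsilon> \<le> 1"
  shows "tilt \<epsilon> f \<in> holder_functions \<alpha> F_square"
proof -
  have "\<bar>tilt \<epsilon> f p - tilt \<epsilon> f q\<bar> \<le> dist p q powr \<alpha>" if pq: "p \<in> F_square" "q \<in> F_square" for p q
  proof -
    have "\<bar>snd p - snd q\<bar> \<le> dist p q" using dist_snd_le[of p q] by (simp add: dist_real_def)
    also have "\<dots> \<le> dist p q powr \<alpha>"
      using assms dist_F_square_le_1[OF pq] by (intro le_powr_of_le_1) auto
    finally have s: "\<bar>snd p - snd q\<bar> \<le> dist p q powr \<alpha>" .
    have f: "\<bar>f p - f q\<bar> \<le> dist p q powr \<alpha>" using assms(3) pq by (simp add: holder_functions_def)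
    have "tilt \<epsilon> f p - tilt \<epsilon> f q = (1 - \<epsilon>) * (f p - f q) + \<epsilon> * (snd p - snd q)"
      using pq by (simp add: tilt_def algebra_simps)
    also have "\<bar>\<dots>\<bar> \<le> (1 - \<epsilon>) * \<bar>f p - f q\<bar> + \<epsilon> * \<bar>snd p - snd q\<bar>"
      using assms(4,5) by (intro order_trans[OF abs_triangle_ineq]) (simp add: abs_mult)
    also have "\<dots> \<le> (1 - \<epsilon>) * (dist p q powr \<alpha>) + \<epsilon> * (dist p q powr \<alpha>)"
      using assms(4,5) f s by (intro add_mono mult_left_mono) auto
    also have "\<dots> = dist p q powr \<alpha>" by (simp add: algebra_simps)
    finally show ?thesis .
  qed
  then show ?thesis by (auto simp: holder_functions_def tilt_def)
qed

lemma window_osc_tilt: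
  assumes "0 \<le> \<epsilon>" "\<epsilon> \<le> 1" "x \<in> F0" "2 \<le> n"
  shows "window_osc (tilt \<epsilon> f) n x \<ge> \<epsilon> * grid n - window_osc f n x"
proof -
  let ?d = "f (x, 1/2 - grid n) - f (x, 1/2)"
  have "tilt \<epsilon> f (x, 1/2 - grid n) - tilt \<epsilon> f (x, 1/2) = (1 - \<epsilon>) * ?d - \<epsilon> * grid n"
    using assms half_in_F0 half_minus_grid_in_F0[OF assms(4)]
    by (simp add: tilt_def F_square_def algebra_simps)
  moreover have "\<bar>(1 - \<epsilon>) * ?d\<bar> \<le> \<bar>?d\<bar>"
    using assms by (simp add: abs_mult mult_left_le_one_le)
  ultimately show ?thesis unfolding window_osc_def by linarith
qed

text \<open>If \<open>f\<close> is not oscillating, then for large \<open>n\<close> its difference over the window is below \<open>\<epsilon>/2\<close> window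
  lengths on almost every column, because \<open>gap_tail \<alpha> n\<close> is then below \<open>\<epsilon>/4\<close>. The added term
  contributes a difference of \<open>\<epsilon>\<close> window lengths and prevails.\<close>

lemma tilt_oscillating:
  assumes \<alpha>: "0 < \<alpha>" "\<alpha> \<le> 1" and f: "f \<in> holder_functions \<alpha> F_square" "f \<notin> oscillating \<alpha>"
    and \<epsilon>: "0 < \<epsilon>" "\<epsilon> \<le> 1"
  shows "tilt \<epsilon> f \<in> oscillating \<alpha>"
proof -
  let ?g = "tilt \<epsilon> f"
  have g: "?g \<in> holder_functions \<alpha> F_square" using \<alpha> f \<epsilon> by (intro tilt_holder) auto
  have "eventually (\<lambda>n. gap_tail \<alpha> n < \<epsilon>/4) sequentially"
    using gap_tail_tendsto_0[OF \<alpha>(1)] \<epsilon>(1) by (intro order_tendstoD) auto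
  then have "eventually (\<lambda>n. gap_tail \<alpha> n < \<epsilon>/4 \<and> 2 \<le> n) sequentially"
    using eventually_ge_at_top[of 2] by (rule eventually_conj)
  then obtain n where n: "gap_tail \<alpha> n < \<epsilon>/4" "2 \<le> n"
    using eventually_happens'[OF sequentially_bot] by blast
  \<comment> \<open>A window difference of \<open>\<epsilon> * grid n = 4 * \<eta>\<close> is produced by the tilt; \<open>f\<close> takes back at most \<open>2 * \<eta>\<close>, and the threshold for oscillation is at most \<open>2 * \<eta>\<close>.\<close>
  define \<eta> where "\<eta> = grid n * \<epsilon>/4"
  have \<eta>: "0 < \<eta>" using \<epsilon> by (simp add: \<eta>_def)
  have null: "emeasure lborel (osc_set \<alpha> f n \<eta>) = 0"
    using f n(2) \<eta> by (auto simp: oscillating_def zero_less_iff_neq_zero)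
  have tail: "grid n * gap_tail \<alpha> n \<le> \<eta>"
    using n(1) mult_left_mono[of "gap_tail \<alpha> n" "\<epsilon>/4" "grid n"] grid_pos[of n] by (simp add: \<eta>_def less_imp_le)
  have "F0 \<subseteq> osc_set \<alpha> f n \<eta> \<union> osc_set \<alpha> ?g n \<eta>"
  proof
    fix x assume x: "x \<in> F0"
    show "x \<in> osc_set \<alpha> f n \<eta> \<union> osc_set \<alpha> ?g n \<eta>"
    proof (cases "x \<in> osc_set \<alpha> f n \<eta>")
      case False
      then have "window_osc f n x < grid n * gap_tail \<alpha> n + \<eta>" using x by (simp add: osc_set_def)
      then have "window_osc f n x < 2 * \<eta>" using tail by linarith
      moreover have "window_osc ?g n x \<ge> \<epsilon> * grid n - window_osc f n x"
        using x n \<epsilon> by (intro window_osc_tilt) auto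
      moreover have "\<epsilon> * grid n = 4 * \<eta>" by (simp add: \<eta>_def)
      ultimately have "window_osc ?g n x \<ge> grid n * gap_tail \<alpha> n + \<eta>" using tail by linarith
      then show ?thesis using x by (simp add: osc_set_def)
    qed simp
  qed
  moreover have meas: "osc_set \<alpha> h n \<eta> \<in> sets lborel" if "h \<in> holder_functions \<alpha> F_square" for h
    using compact_osc_set[OF \<alpha>(1) that n(2)] by (simp add: borel_closed compact_imp_closed)
  ultimately have "emeasure lborel F0 \<le> emeasure lborel (osc_set \<alpha> f n \<eta>) + emeasure lborel (osc_set \<alpha> ?g n \<eta>)"
    using meas[OF f(1)] meas[OF g] by (intro order_trans[OF emeasure_mono emeasure_subadditive]) auto
  then have "0 < emeasure lborel (osc_set \<alpha> ?g n \<eta>)" using emeasure_F0_pos null by (simp add: less_le_trans)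
  then show ?thesis using g n(2) \<eta> unfolding oscillating_def by blast
qed

lemma dense_oscillating:
  assumes \<alpha>: "0 < \<alpha>" "\<alpha> \<le> 1"
  shows "mtopology_of (holder_space \<alpha> F_square) closure_of (oscillating \<alpha>) = mspace (holder_space \<alpha> F_square)"
proof -
  interpret holder_setting \<alpha> F_square by (rule holder_setting_F_square[OF \<alpha>(1)])
  have "\<exists>g\<in>oscillating \<alpha>. \<forall>x\<in>F_square. \<bar>f x - g x\<bar> \<le> e" if f: "f \<in> H" and e: "0 < e" for f e
  proof (cases "f \<in> oscillating \<alpha>")
    case True
    then show ?thesis using e by (intro bexI[of _ f]) auto
  next
    case False
    have "compact (f ` F_square)"
      using f \<alpha> compact_F_square by (intro compact_continuous_image continuous_on_holder_function)
    then obtain B where B: "0 < B" "\<And>p. p \<in> F_square \<Longrightarrow> \<bar>f p\<bar> \<le> B"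
      using compact_imp_bounded[of "f ` F_square"] by (auto simp: bounded_pos)
    define \<epsilon> where "\<epsilon> = min 1 (e / (B + 1))"
    have "\<epsilon> * (B + 1) \<le> e / (B + 1) * (B + 1)"
      using B(1) by (intro mult_right_mono) (simp_all add: \<epsilon>_def)
    then have \<epsilon>: "0 < \<epsilon>" "\<epsilon> \<le> 1" "\<epsilon> * (B + 1) \<le> e"
      using B(1) e by (simp_all add: \<epsilon>_def)
    have "\<bar>f p - tilt \<epsilon> f p\<bar> \<le> e" if p: "p \<in> F_square" for p
    proof -
      have "f p - tilt \<epsilon> f p = \<epsilon> * (f p - snd p)" using p by (simp add: tilt_def algebra_simps)
      then have "\<bar>f p - tilt \<epsilon> f p\<bar> = \<epsilon> * \<bar>f p - snd p\<bar>" using \<epsilon> by (simp add: abs_mult)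
      also have "\<bar>f p - snd p\<bar> \<le> B + 1"
        using B(2)[OF p] p F0_bounds[of "snd p"] by (auto simp: F_square_def)
      then have "\<epsilon> * \<bar>f p - snd p\<bar> \<le> \<epsilon> * (B + 1)" using \<epsilon> by (intro mult_left_mono) auto
      finally show ?thesis using \<epsilon>(3) by linarith
    qed
    moreover have "tilt \<epsilon> f \<in> oscillating \<alpha>" by (rule tilt_oscillating[OF \<alpha> f False \<epsilon>(1,2)])
    ultimately show ?thesis by blast
  qed
  then show ?thesis
    unfolding mspace_eq by (subst dense_holder_iff) (auto simp: oscillating_def)
qed

lemma emeasure_column_range:
  assumes \<alpha>: "0 < \<alpha>" and n: "2 \<le> n" and \<eta>: "0 < \<eta>" and f: "f \<in> holder_functions \<alpha> F_square"
    and x: "x \<in> osc_set \<alpha> f n \<eta>"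
  shows "ennreal \<eta> \<le> emeasure lborel ((\<lambda>y. f (x, y)) ` (F0 \<inter> {1/2 - grid n..1/2}))"
    (is "_ \<le> ?m")
proof -
  have xF: "x \<in> F0" using x by (simp add: osc_set_def)
  have t: "0 \<le> grid n * gap_tail \<alpha> n"
    unfolding gap_tail_def by (intro mult_nonneg_nonneg suminf_nonneg
       summable_ignore_initial_segment[OF summable_gap_ratio[OF \<alpha>]]) (auto simp: less_imp_le)
  have "ennreal (grid n * gap_tail \<alpha> n) + ennreal \<eta> = ennreal (grid n * gap_tail \<alpha> n + \<eta>)"
    using t \<eta> by simp
  also have "\<dots> \<le> ennreal (window_osc f n x)"
    using x by (intro ennreal_leI) (simp add: osc_set_def)
  also have "\<dots> \<le> ?m + ennreal (grid n * gap_tail \<alpha> n)"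
    unfolding window_osc_def
  proof (rule emeasure_range_window[OF \<alpha> n])
    fix y z assume "y \<in> F0" "z \<in> F0"
    then have "\<bar>f (x, y) - f (x, z)\<bar> \<le> dist (x, y) (x, z) powr \<alpha>"
      using f xF by (simp add: holder_functions_def F_square_def)
    then show "\<bar>f (x, y) - f (x, z)\<bar> \<le> \<bar>y - z\<bar> powr \<alpha>" by (simp add: dist_Pair_Pair dist_real_def)
  qed
  finally show ?thesis by (simp add: add.commute[of ?m] ennreal_add_left_cancel_le)
qed

text \<open>The set \<open>A\<close> of pairs of a column and a level attained on it in the window is compact, and its sections
  over the oscillating columns have length at least \<open>\<eta>\<close>. By Fubini the sections at constant level have
  positive length for a set of levels of positive measure, and each of them lies in the projection
  of the corresponding level set.\<close>

lemma D_star_fun_oscillating: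
  assumes \<alpha>: "0 < \<alpha>" and f: "f \<in> oscillating \<alpha>"
  shows "1 \<le> D_star_fun f F_square"
proof -
  from f obtain n \<eta> where n: "2 \<le> n" and \<eta>: "0 < \<eta>" "0 < emeasure lborel (osc_set \<alpha> f n \<eta>)"
    and fH: "f \<in> holder_functions \<alpha> F_square"
    unfolding oscillating_def by auto
  have cont: "continuous_on F_square f" using fH \<alpha> by (rule continuous_on_holder_function)
  define S where "S = osc_set \<alpha> f n \<eta>"
  define K where "K = F0 \<inter> {1/2 - grid n..1/2}"
  define A where "A = (\<lambda>p. (fst p, f p)) ` (S \<times> K)"
  have S: "compact S" unfolding S_def by (rule compact_osc_set[OF \<alpha> fH n])
  have K: "compact K" unfolding K_def using compact_F0 by (intro compact_Int_closed) auto
  have SK: "S \<times> K \<subseteq> F_square" by (auto simp: S_def K_def osc_set_def F_square_def)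
  have "compact A" unfolding A_def using S K
    by (intro compact_continuous_image compact_Times continuous_intros continuous_on_subset[OF cont SK])
  then have "A \<in> sets lborel" by (simp add: borel_closed compact_imp_closed)
  then have A: "A \<in> sets (lborel \<Otimes>\<^sub>M lborel)" by (simp only: lborel_prod)
  have S_meas: "S \<in> sets lborel" using S by (simp add: borel_closed compact_imp_closed)
  have "ennreal \<eta> * indicator S x \<le> emeasure lborel (Pair x -` A)" for x
  proof (cases "x \<in> S")
    case True
    then have "Pair x -` A = (\<lambda>y. f (x, y)) ` K" by (auto simp: A_def image_iff)
    then show ?thesis using emeasure_column_range[OF \<alpha> n \<eta>(1) fH] True by (simp add: S_def K_def)
  qed simp
  then have "(\<integral>\<^sup>+x. ennreal \<eta> * indicator S x \<partial>lborel) \<le> (\<integral>\<^sup>+x. emeasure lborel (Pair x -` A) \<partial>lborel)"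
    by (intro nn_integral_mono)
  also have "\<dots> = emeasure (lborel \<Otimes>\<^sub>M lborel) A"
    using A by (rule lborel.emeasure_pair_measure_alt[symmetric])
  also have "\<dots> = (\<integral>\<^sup>+r. emeasure lborel ((\<lambda>x. (x, r)) -` A) \<partial>lborel)"
    using A by (rule lborel_pair.emeasure_pair_measure_alt2)
  finally have "ennreal \<eta> * emeasure lborel S \<le> (\<integral>\<^sup>+r. emeasure lborel ((\<lambda>x. (x, r)) -` A) \<partial>lborel)"
    using S_meas by (simp add: nn_integral_cmult_indicator)
  moreover have "ennreal \<eta> * emeasure lborel S \<noteq> 0" using \<eta> by (simp add: S_def)
  ultimately have int: "(\<integral>\<^sup>+r. emeasure lborel ((\<lambda>x. (x, r)) -` A) \<partial>lborel) \<noteq> 0" by auto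
  define R where "R = {r. emeasure lborel ((\<lambda>x. (x, r)) -` A) \<noteq> 0}"
  have meas: "(\<lambda>r. emeasure lborel ((\<lambda>x. (x, r)) -` A)) \<in> borel_measurable lborel"
    using A by (rule lborel_pair.measurable_emeasure_Pair2)
  have R: "emeasure lborel R \<noteq> 0"
    using int unfolding nn_integral_0_iff[OF meas] R_def by simp
  have sub: "R \<subseteq> {r. ereal 1 \<le> level_dim f r F_square}"
  proof
    fix r assume r: "r \<in> R"
    have "1 \<le> hausdorff_dim {p \<in> F_square. f p = r}"
    proof (rule hausdorff_dim_ge_1_if_projection_pos)
      show "\<bar>fst p - fst q\<bar> \<le> dist p q" for p q :: "real \<times> real"
        using dist_fst_le[of p q] by (simp add: dist_real_def)
      show "(\<lambda>x. (x, r)) -` A \<in> sets borel"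
        using sets_Pair2[OF A, of r] by simp
      show "(\<lambda>x. (x, r)) -` A \<subseteq> fst ` {p \<in> F_square. f p = r}"
      proof
        fix x assume "x \<in> (\<lambda>x. (x, r)) -` A"
        then obtain p where "p \<in> S \<times> K" "x = fst p" "r = f p" by (auto simp: A_def)
        then show "x \<in> fst ` {p \<in> F_square. f p = r}" using SK by blast
      qed
      show "0 < emeasure lborel ((\<lambda>x. (x, r)) -` A)"
        using r by (simp add: R_def zero_less_iff_neq_zero)
    qed
    then show "r \<in> {r. ereal 1 \<le> level_dim f r F_square}" by (simp add: level_dim_def one_ereal_def)
  qed
  have D: "{r. ereal 1 \<le> level_dim f r F_square} \<in> sets lborel"
    using level_dim_ge_borel[OF compact_F_square cont] by simp
  have "emeasure lborel R \<le> emeasure lborel {r. ereal 1 \<le> level_dim f r F_square}"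
    using sub D by (rule emeasure_mono)
  also have "\<dots> = emeasure lebesgue {r. ereal 1 \<le> level_dim f r F_square}"
    using D by simp
  finally have "0 < emeasure lebesgue {r. ereal 1 \<le> level_dim f r F_square}"
    using R by (auto simp: zero_less_iff_neq_zero)
  then show ?thesis unfolding D_star_fun_def one_ereal_def by (intro Sup_upper) simp
qed

lemma D_star_ge_1:
  assumes "0 < \<alpha>" "\<alpha> \<le> 1"
  shows "1 \<le> D_star \<alpha> F_square"
proof -
  have "oscillating \<alpha> \<in> dense_gdelta_sets \<alpha> F_square"
    using assms by (simp add: dense_gdelta_sets_def open_imp_gdelta_in openin_oscillating dense_oscillating)
  moreover have "1 \<le> (INF f\<in>oscillating \<alpha>. D_star_fun f F_square)"
    using assms by (intro INF_greatest D_star_fun_oscillating)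
  ultimately show ?thesis using assms by (auto simp: D_star_def intro: SUP_upper2)
qed

section \<open>Lipschitz functions are dense\<close>

text \<open>A concave modulus of continuity below the \<open>\<alpha>\<close>-Hoelder one. Being subadditive, it turns the distance
  into a new metric, with respect to which functions are both \<open>\<alpha>\<close>-Hoelder and Lipschitz.\<close>

definition capped_modulus :: "real \<Rightarrow> real \<Rightarrow> real \<Rightarrow> real" where
  "capped_modulus \<alpha> L t = min (t powr \<alpha>) (L * t)"

lemma capped_modulus_mono:
  assumes "0 < \<alpha>" "0 \<le> L" "0 \<le> t" "t \<le> u"
  shows "capped_modulus \<alpha> L t \<le> capped_modulus \<alpha> L u"
  unfolding capped_modulus_def using assms
  by (intro min.mono powr_mono2 mult_left_mono) auto

lemma capped_modulus_ge_slope: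
  assumes "0 < \<alpha>" "\<alpha> \<le> 1" "0 \<le> L" "0 \<le> a" "a \<le> s" "0 < s"
  shows "a * min (s powr (\<alpha> - 1)) L \<le> capped_modulus \<alpha> L a"
proof (cases "a = 0")
  case False
  then have "s powr (\<alpha> - 1) \<le> a powr (\<alpha> - 1)" using assms by (intro powr_mono2') auto
  then have "a * min (s powr (\<alpha> - 1)) L \<le> a * min (a powr (\<alpha> - 1)) L"
    using assms by (intro mult_left_mono min.mono) auto
  also have "\<dots> = min (a * a powr (\<alpha> - 1)) (a * L)"
    using assms by (simp add: min_mult_distrib_left)
  also have "a * a powr (\<alpha> - 1) = a powr \<alpha>" using False assms by (simp add: powr_mult_base)
  finally show ?thesis by (simp add: capped_modulus_def mult.commute)
qed (simp add: capped_modulus_def)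

text \<open>This holds because \<open>capped_modulus \<alpha> L t / t = min (t powr (\<alpha> - 1)) L\<close> is nonincreasing in \<open>t\<close>.\<close>

lemma capped_modulus_subadditive:
  assumes "0 < \<alpha>" "\<alpha> \<le> 1" "0 \<le> L" "0 \<le> a" "0 \<le> b"
  shows "capped_modulus \<alpha> L (a + b) \<le> capped_modulus \<alpha> L a + capped_modulus \<alpha> L b"
proof (cases "a + b = 0")
  case True
  then show ?thesis using assms by (simp add: capped_modulus_def)
next
  case False
  then have s: "0 < a + b" using assms by linarith
  let ?c = "min ((a + b) powr (\<alpha> - 1)) L"
  have "capped_modulus \<alpha> L (a + b) = min ((a + b) * (a + b) powr (\<alpha> - 1)) ((a + b) * L)"
    using s by (simp add: capped_modulus_def powr_mult_base mult.commute)
  also have "\<dots> = (a + b) * ?c" using s by (simp add: min_mult_distrib_left)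
  also have "\<dots> = a * ?c + b * ?c" by (simp add: distrib_right)
  also have "\<dots> \<le> capped_modulus \<alpha> L a + capped_modulus \<alpha> L b"
    using assms s by (intro add_mono capped_modulus_ge_slope) auto
  finally show ?thesis .
qed

text \<open>The modulus differs from \<open>t powr \<alpha>\<close> only where \<open>L * t\<close> is the smaller term, that is, for small \<open>t\<close>;
  \<open>L\<close> is chosen so that \<open>t powr \<alpha> < e\<close> there.\<close>

lemma capped_modulus_approx:
  assumes "0 < \<alpha>" "\<alpha> \<le> 1" "0 < e"
  shows "\<exists>L>0. \<forall>t\<ge>0. t powr \<alpha> \<le> capped_modulus \<alpha> L t + e"
proof -
  \<comment> \<open>The point where \<open>t powr \<alpha>\<close> reaches \<open>e\<close>; the line of slope \<open>L\<close> passes through the graph there.\<close>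
  define t0 where "t0 = e powr (1 / \<alpha>)"
  define L where "L = t0 powr (\<alpha> - 1)"
  have t0: "0 < t0" "t0 powr \<alpha> = e" using assms by (simp_all add: t0_def powr_powr)
  then have L: "0 < L" by (simp add: L_def)
  have "t powr \<alpha> \<le> capped_modulus \<alpha> L t + e" if t: "0 \<le> t" for t
  proof (cases "t \<le> t0")
    case True
    then have "t powr \<alpha> \<le> e" using powr_mono2[of \<alpha> t t0] t assms t0 by simp
    moreover have "0 \<le> capped_modulus \<alpha> L t" using t L by (simp add: capped_modulus_def)
    ultimately show ?thesis by linarith
  next
    case False
    then have "t powr (\<alpha> - 1) \<le> L" unfolding L_def using t0 assms by (intro powr_mono2') auto
    then have "t * t powr (\<alpha> - 1) \<le> t * L" using t by (rule mult_left_mono)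
    then have "t powr \<alpha> \<le> L * t" using False t0 by (simp add: powr_mult_base mult.commute)
    then show ?thesis using assms by (simp add: capped_modulus_def)
  qed
  with L show ?thesis by blast
qed

text \<open>The approximation is the infimal convolution of \<open>f\<close> with the capped modulus. It is the largest
  minorant of \<open>f\<close> with this modulus of continuity, so the Hoelder constant \<open>1\<close> is kept.\<close>

lemma (in holder_setting) lipschitz_approximation:
  assumes \<alpha>: "\<alpha> \<le> 1" and f: "f \<in> H" and e: "0 < e"
  shows "\<exists>g\<in>H. \<exists>L>0. (\<forall>x\<in>F. \<forall>y\<in>F. \<bar>g x - g y\<bar> \<le> L * dist x y) \<and> (\<forall>x\<in>F. \<bar>f x - g x\<bar> \<le> e)"
proof -
  obtain L where L: "0 < L" "\<And>t. 0 \<le> t \<Longrightarrow> t powr \<alpha> \<le> capped_modulus \<alpha> L t + e"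
    using capped_modulus_approx[OF alpha_pos \<alpha> e] by blast
  let ?\<omega> = "capped_modulus \<alpha> L"
  define g where "g = restrict (\<lambda>x. INF y\<in>F. f y + ?\<omega> (dist x y)) F"
  have low: "f x - e \<le> f y + ?\<omega> (dist x y)" if "x \<in> F" "y \<in> F" for x y
  proof -
    have "\<bar>f x - f y\<bar> \<le> dist x y powr \<alpha>" using f that by (simp add: holder_functions_def)
    then show ?thesis using L(2)[of "dist x y"] by simp
  qed
  then have bdd: "bdd_below ((\<lambda>y. f y + ?\<omega> (dist x y)) ` F)" if "x \<in> F" for x
    using that by (intro bdd_belowI2)
  have g_le: "g x \<le> f y + ?\<omega> (dist x y)" if "x \<in> F" "y \<in> F" for x y
    using that bdd by (auto simp: g_def intro: cINF_lower)
  have g_ge: "c \<le> g x" if "x \<in> F" "\<And>y. y \<in> F \<Longrightarrow> c \<le> f y + ?\<omega> (dist x y)" for x c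
    using that F_nonempty by (auto simp: g_def intro: cINF_greatest)
  have near: "\<bar>f x - g x\<bar> \<le> e" if "x \<in> F" for x
    using g_le[OF that that] g_ge[OF that low[OF that]] e by (simp add: capped_modulus_def) 
  have half: "g x \<le> g z + ?\<omega> (dist x z)" if "x \<in> F" "z \<in> F" for x z
  proof -
    have "g x - ?\<omega> (dist x z) \<le> g z"
    proof (rule g_ge[OF that(2)])
      fix y assume y: "y \<in> F"
      have "g x \<le> f y + ?\<omega> (dist x y)" by (rule g_le[OF that(1) y])
      also have "?\<omega> (dist x y) \<le> ?\<omega> (dist x z + dist z y)"
        using L alpha_pos by (intro capped_modulus_mono dist_triangle) auto
      also have "\<dots> \<le> ?\<omega> (dist x z) + ?\<omega> (dist z y)"
        using L alpha_pos \<alpha> by (intro capped_modulus_subadditive) auto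
      finally show "g x - ?\<omega> (dist x z) \<le> f y + ?\<omega> (dist z y)" by linarith
    qed
    then show ?thesis by linarith
  qed
  have mod: "\<bar>g x - g z\<bar> \<le> ?\<omega> (dist x z)" if "x \<in> F" "z \<in> F" for x z
    using half[OF that] half[OF that(2,1)] by (simp add: dist_commute abs_le_iff)
  have "\<bar>g x - g z\<bar> \<le> dist x z powr \<alpha>" "\<bar>g x - g z\<bar> \<le> L * dist x z" if "x \<in> F" "z \<in> F" for x z
    using mod[OF that] by (simp_all add: capped_modulus_def)
  moreover from this have "g \<in> H" by (simp add: holder_functions_def g_def)
  ultimately show ?thesis using near L(1) by (intro bexI[of _ g] exI[of _ L]) auto
qed

section \<open>Generic level sets have dimension at most one\<close>

text \<open>The strict bound \<open>c < 1/N\<close> makes the condition open. The condition on \<open>L\<close> says that the Lipschitz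
  constant is small compared to \<open>N powr (1 / Suc n)\<close>, so that it does not influence the dimension of
  level sets when \<open>n\<close> tends to infinity.\<close>

definition nearly_lipschitz :: "real \<Rightarrow> nat \<Rightarrow> (real \<times> real \<Rightarrow> real) set" where
  "nearly_lipschitz \<alpha> n = {f \<in> holder_functions \<alpha> F_square.
     \<exists>g L N. 0 < L \<and> (\<forall>p\<in>F_square. \<forall>q\<in>F_square. \<bar>g p - g q\<bar> \<le> L * dist p q)
       \<and> n < N \<and> (L + 1) * real N powr (- 1 / Suc n) \<le> 1 / Suc n
       \<and> (\<exists>c<1 / real N. \<forall>p\<in>F_square. \<bar>f p - g p\<bar> \<le> c)}"

lemma openin_nearly_lipschitz:
  assumes "0 < \<alpha>"
  shows "openin (mtopology_of (holder_space \<alpha> F_square)) (nearly_lipschitz \<alpha> n)"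
proof -
  interpret holder_setting \<alpha> F_square by (rule holder_setting_F_square[OF assms])
  show ?thesis
  proof (rule openin_holderI)
    show "nearly_lipschitz \<alpha> n \<subseteq> H" by (auto simp: nearly_lipschitz_def)
    fix f assume "f \<in> nearly_lipschitz \<alpha> n"
    then obtain g L N c where g: "0 < L" "\<forall>p\<in>F_square. \<forall>q\<in>F_square. \<bar>g p - g q\<bar> \<le> L * dist p q"
       "n < N" "(L + 1) * real N powr (- 1 / Suc n) \<le> 1 / Suc n"
       and c: "c < 1 / real N" "\<forall>p\<in>F_square. \<bar>f p - g p\<bar> \<le> c"
      unfolding nearly_lipschitz_def by blast
    define e where "e = (1 / real N - c) / 2"
    have e: "0 < e" "c + e < 1 / real N" using c(1) by (auto simp: e_def field_simps)
    have "h \<in> nearly_lipschitz \<alpha> n" if h: "h \<in> H" "\<forall>p\<in>F_square. \<bar>f p - h p\<bar> \<le> e" for h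
    proof -
      have "\<forall>p\<in>F_square. \<bar>h p - g p\<bar> \<le> c + e"
      proof
        fix p assume "p \<in> F_square"
        then have "\<bar>f p - h p\<bar> \<le> e" "\<bar>f p - g p\<bar> \<le> c" using h c by auto
        then show "\<bar>h p - g p\<bar> \<le> c + e" by linarith
      qed
      then show ?thesis using g e(2) h(1) unfolding nearly_lipschitz_def by blast
    qed
    then show "\<exists>e>0. \<forall>h\<in>H. (\<forall>p\<in>F_square. \<bar>f p - h p\<bar> \<le> e) \<longrightarrow> h \<in> nearly_lipschitz \<alpha> n"
      using e(1) by blast
  qed
qed

lemma dense_nearly_lipschitz:
  assumes \<alpha>: "0 < \<alpha>" "\<alpha> \<le> 1"
  shows "mtopology_of (holder_space \<alpha> F_square) closure_of (nearly_lipschitz \<alpha> n) = holder_functions \<alpha> F_square"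
proof -
  interpret holder_setting \<alpha> F_square by (rule holder_setting_F_square[OF \<alpha>(1)])
  have "\<exists>g\<in>nearly_lipschitz \<alpha> n. \<forall>p\<in>F_square. \<bar>f p - g p\<bar> \<le> e" if f: "f \<in> H" and e: "0 < e" for f e
  proof -
    obtain g L where g: "g \<in> H" "0 < L" "\<forall>p\<in>F_square. \<forall>q\<in>F_square. \<bar>g p - g q\<bar> \<le> L * dist p q"
      "\<forall>p\<in>F_square. \<bar>f p - g p\<bar> \<le> e" using lipschitz_approximation[OF \<alpha>(2) f e] by blast
    have "((\<lambda>N. real N powr (- 1 / Suc n)) \<longlongrightarrow> 0) sequentially"
      by (rule tendsto_neg_powr[OF _ filterlim_real_sequentially]) (simp add: field_simps)
    then have "((\<lambda>N. (L + 1) * real N powr (- 1 / Suc n)) \<longlongrightarrow> (L + 1) * 0) sequentially"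
      by (intro tendsto_mult_left)
    then have "eventually (\<lambda>N. (L + 1) * real N powr (- 1 / Suc n) < 1 / Suc n) sequentially"
      by (intro order_tendstoD) auto
    then have "eventually (\<lambda>N. (L + 1) * real N powr (- 1 / Suc n) < 1 / Suc n \<and> n < N) sequentially"
      using eventually_gt_at_top[of n] by (rule eventually_conj)
    then obtain N where N: "(L + 1) * real N powr (- 1 / Suc n) < 1 / Suc n" "n < N"
      using eventually_happens'[OF sequentially_bot] by blast
    have "0 < 1 / real N" using N(2) by simp
    then have "\<exists>c<1 / real N. \<forall>p\<in>F_square. \<bar>g p - g p\<bar> \<le> c" by (intro exI[of _ 0]) simp
    then have "g \<in> nearly_lipschitz \<alpha> n"
      using g(1-3) N(2) less_imp_le[OF N(1)] unfolding nearly_lipschitz_def mem_Collect_eq by blast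
    then show ?thesis using g(4) by blast
  qed
  then show ?thesis
    by (subst dense_holder_iff) (auto simp: nearly_lipschitz_def)
qed

text \<open>The part of the fractal in one square of side \<open>1/N\<close>. The two coordinates of the square are merged
  into a single number below \<open>N * N\<close>, which is used as the index in a cover.\<close>

definition cell :: "nat \<Rightarrow> nat \<Rightarrow> (real \<times> real) set" where
  "cell N m = {p \<in> F_square. nat \<lfloor>N * fst p\<rfloor> * N + nat \<lfloor>N * snd p\<rfloor> = m}"

lemma cell_index:
  assumes "p \<in> F_square" "0 < N"
  shows "nat \<lfloor>N * fst p\<rfloor> < N" "nat \<lfloor>N * snd p\<rfloor> < N"
proof -
  have "0 \<le> fst p" "fst p < 1" "0 \<le> snd p" "snd p < 1"
    using assms F0_bounds[of "fst p"] F0_bounds[of "snd p"] by (auto simp: F_square_def)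
  then have "\<lfloor>N * fst p\<rfloor> < int N" "\<lfloor>N * snd p\<rfloor> < int N"
    using assms(2) by (simp_all add: floor_less_iff)
  then show "nat \<lfloor>N * fst p\<rfloor> < N" "nat \<lfloor>N * snd p\<rfloor> < N" using assms(2) by simp_all
qed

lemma abs_diff_le_of_floor_eq:
  assumes "0 < N" "0 \<le> x" "0 \<le> y" "nat \<lfloor>real N * x\<rfloor> = nat \<lfloor>real N * y\<rfloor>"
  shows "\<bar>x - y\<bar> \<le> 1 / real N"
proof -
  have "\<lfloor>real N * x\<rfloor> = \<lfloor>real N * y\<rfloor>" using assms by (simp add: eq_nat_nat_iff)
  then have "\<bar>real N * x - real N * y\<bar> \<le> 1" by linarith
  then have "real N * \<bar>x - y\<bar> \<le> 1" using assms(1) by (simp add: abs_mult flip: right_diff_distrib)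
  then show ?thesis using assms(1) by (simp add: field_simps)
qed

lemma dist_cell_le:
  assumes "0 < N" "p \<in> cell N m" "q \<in> cell N m"
  shows "dist p q \<le> 2 / real N"
proof -
  have F: "p \<in> F_square" "q \<in> F_square" using assms by (auto simp: cell_def)
  have eq: "nat \<lfloor>N * fst p\<rfloor> * N + nat \<lfloor>N * snd p\<rfloor> = nat \<lfloor>N * fst q\<rfloor> * N + nat \<lfloor>N * snd q\<rfloor>"
    using assms by (simp add: cell_def)
  from arg_cong[OF eq, of "\<lambda>k. k mod N"] have b: "nat \<lfloor>N * snd p\<rfloor> = nat \<lfloor>N * snd q\<rfloor>"
    using cell_index[OF F(1) assms(1)] cell_index[OF F(2) assms(1)] by simp
  with eq assms(1) have a: "nat \<lfloor>N * fst p\<rfloor> = nat \<lfloor>N * fst q\<rfloor>" by simp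
  have pos: "0 \<le> fst p" "0 \<le> snd p" "0 \<le> fst q" "0 \<le> snd q"
    using F F0_bounds by (auto simp: F_square_def)
  have "dist p q \<le> \<bar>fst p - fst q\<bar> + \<bar>snd p - snd q\<bar>"
    unfolding dist_prod_def dist_real_def by (rule order_trans[OF sqrt_sum_squares_le_sum_abs]) simp
  also have "\<dots> \<le> 1 / real N + 1 / real N"
    using a b pos assms(1) by (intro add_mono abs_diff_le_of_floor_eq)
  finally show ?thesis by simp
qed

lemma diameter_cell_le:
  assumes "0 < N"
  shows "bounded (cell N m)" "diameter (cell N m) \<le> 2 / real N"
proof -
  show "bounded (cell N m)"
    using compact_imp_bounded[OF compact_F_square] by (rule bounded_subset) (auto simp: cell_def)
  have "(SUP (p, q)\<in>cell N m \<times> cell N m. dist p q) \<le> 2 / real N" if "cell N m \<noteq> {}"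
    using that dist_cell_le[OF assms] by (intro cSUP_least) auto
  then show "diameter (cell N m) \<le> 2 / real N"
    using assms by (simp add: diameter_def)
qed

lemma F_square_covered_by_cells:
  assumes "p \<in> F_square" "0 < N"
  shows "\<exists>m<N * N. p \<in> cell N m"
proof -
  let ?a = "nat \<lfloor>N * fst p\<rfloor>" and ?b = "nat \<lfloor>N * snd p\<rfloor>"
  have "?a * N + ?b < ?a * N + N" using cell_index[OF assms] by simp
  also have "\<dots> = Suc ?a * N" by simp
  also have "\<dots> \<le> N * N" using cell_index[OF assms] by (intro mult_right_mono) auto
  finally show ?thesis using assms(1) by (auto simp: cell_def)
qed

text \<open>\<open>E r\<close> bounds the sum for the cover of the level set by those cells that can meet it. On a cell \<open>f\<close>
  varies by at most \<open>\<rho> = (2 * L + 2) / N\<close>, where \<open>2 * L / N\<close> comes from the Lipschitz approximation and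
  \<open>2 / N\<close> from its error. So every cell contributes to a set of levels of length at most \<open>2 * \<rho>\<close>, and the
  \<open>N\<^sup>2\<close> cells together give an integral of order \<open>(L + 1) * N powr (1 - s)\<close>.\<close>

lemma level_cover_energy:
  assumes f: "f \<in> nearly_lipschitz \<alpha> n" and s: "1 + 1 / Suc n \<le> s"
  shows "\<exists>E. E \<in> borel_measurable lborel
      \<and> (\<integral>\<^sup>+r. E r \<partial>lborel) \<le> ennreal (4 * 2 powr s / Suc n)
      \<and> (\<forall>r. \<exists>U\<in>delta_covers (2 / Suc n) {p \<in> F_square. f p = r}. (\<Sum>i. diam_power s (U i)) \<le> E r)"
proof -
  from f obtain g L N c where L: "0 < L" and g: "\<forall>p\<in>F_square. \<forall>q\<in>F_square. \<bar>g p - g q\<bar> \<le> L * dist p q"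
       and N: "n < N" "(L + 1) * real N powr (- 1 / Suc n) \<le> 1 / Suc n"
       and c: "c < 1 / real N" "\<forall>p\<in>F_square. \<bar>f p - g p\<bar> \<le> c"
    unfolding nearly_lipschitz_def by blast
  have N0: "0 < N" using N(1) by simp
  have s0: "0 < s" using s by (smt (verit) divide_nonneg_nonneg of_nat_0_le_iff)
  define \<rho> where "\<rho> = (2 * L + 2) / real N"
  define w where "w = (2 / real N) powr s"
  define ctr where "ctr m = (SOME p. p \<in> cell N m)" for m
  define I where "I m = (if cell N m = {} then {} else cball (f (ctr m)) \<rho>)" for m
  define E where "E r = (\<Sum>m<N * N. ennreal w * indicator (I m) r)" for r
  have \<rho>: "0 \<le> \<rho>" using L by (simp add: \<rho>_def)
  have I: "f p \<in> I m" if p: "p \<in> cell N m" for p m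
  proof -
    have ctr: "ctr m \<in> cell N m" unfolding ctr_def using p by (rule someI)
    then have F: "p \<in> F_square" "ctr m \<in> F_square" using p by (auto simp: cell_def)
    have "\<bar>g (ctr m) - g p\<bar> \<le> L * dist (ctr m) p" using g F by blast
    also have "\<dots> \<le> L * (2 / real N)" using L dist_cell_le[OF N0 ctr p] by (intro mult_left_mono) auto
    finally have "\<bar>g (ctr m) - g p\<bar> \<le> L * (2 / real N)" .
    moreover have "\<bar>f p - g p\<bar> \<le> 1 / real N" "\<bar>f (ctr m) - g (ctr m)\<bar> \<le> 1 / real N"
      using c F by force+
    moreover have "\<rho> = L * (2 / real N) + 1 / real N + 1 / real N"
      by (simp add: \<rho>_def add_divide_distrib)
    ultimately have "\<bar>f (ctr m) - f p\<bar> \<le> \<rho>" by linarith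
    then show ?thesis using p by (auto simp: I_def dist_real_def)
  qed
  have I_meas [measurable]: "I m \<in> sets borel" for m by (simp add: I_def)
  have "E \<in> borel_measurable lborel" unfolding E_def by measurable
  moreover have "(\<integral>\<^sup>+r. E r \<partial>lborel) \<le> ennreal (4 * 2 powr s / Suc n)"
  proof -
    have "(\<integral>\<^sup>+r. E r \<partial>lborel) = (\<Sum>m<N * N. ennreal w * emeasure lborel (I m))"
      unfolding E_def by (subst nn_integral_sum) (simp_all add: nn_integral_cmult_indicator)
    also have "\<dots> \<le> (\<Sum>m<N * N. ennreal w * ennreal (2 * \<rho>))"
      using \<rho> by (intro sum_mono mult_left_mono) (auto simp: I_def cball_eq_atLeastAtMost)
    also have "\<dots> = ennreal (real (N * N) * (w * (2 * \<rho>)))"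
      using \<rho> by (simp add: ennreal_mult w_def ennreal_of_nat_eq_real_of_nat)
    also have "real (N * N) * (w * (2 * \<rho>)) = 4 * 2 powr s * ((L + 1) * real N powr (1 - s))"
      using N0 by (simp add: w_def \<rho>_def powr_divide powr_diff field_simps)
    also have "\<dots> \<le> 4 * 2 powr s * ((L + 1) * real N powr (- 1 / Suc n))"
      using L N0 s by (intro mult_left_mono powr_mono) (auto simp: field_simps)
    also have "\<dots> \<le> 4 * 2 powr s * (1 / Suc n)"
      using N(2) by (intro mult_left_mono) auto
    finally show ?thesis by (simp add: ennreal_leI)
  qed
  moreover have "\<exists>U\<in>delta_covers (2 / Suc n) {p \<in> F_square. f p = r}. (\<Sum>i. diam_power s (U i)) \<le> E r" for r
  proof
    define U where "U m = (if m < N * N \<and> r \<in> I m then cell N m else {})" for m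
    have "2 / real N \<le> 2 / Suc n" using N(1) by (intro divide_left_mono) auto
    then show "U \<in> delta_covers (2 / Suc n) {p \<in> F_square. f p = r}"
    proof (intro delta_coversI)
      show "bounded (U i)" for i using diameter_cell_le[OF N0] by (simp add: U_def)
      show "diameter (U i) \<le> 2 / Suc n" for i
        using diameter_cell_le(2)[OF N0, of i] \<open>2 / real N \<le> 2 / Suc n\<close> by (auto simp: U_def intro: order_trans)
      show "{p \<in> F_square. f p = r} \<subseteq> (\<Union>i. U i)"
      proof
        fix p assume p: "p \<in> {p \<in> F_square. f p = r}"
        then obtain m where m: "m < N * N" "p \<in> cell N m" using F_square_covered_by_cells N0 by blast
        then have "p \<in> U m" using I[OF m(2)] p by (simp add: U_def)
        then show "p \<in> (\<Union>i. U i)" by blast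
      qed
    qed
    have "(\<Sum>i. diam_power s (U i)) = (\<Sum>i<N * N. diam_power s (U i))"
      by (intro suminf_finite) (auto simp: U_def)
    also have "\<dots> \<le> E r"
      unfolding E_def
    proof (rule sum_mono)
      fix m
      have "diameter (cell N m) powr s \<le> w"
        unfolding w_def using diameter_cell_le[OF N0] s0 by (intro powr_mono2 diameter_ge_0) auto
      then show "diam_power s (U m) \<le> ennreal w * indicator (I m) r"
        using s0 by (auto simp: U_def diam_power_def ennreal_leI)
    qed
    finally show "(\<Sum>i. diam_power s (U i)) \<le> E r" .
  qed
  ultimately show ?thesis by blast
qed

text \<open>The integrals of the functions \<open>E n\<close> tend to \<open>0\<close>, so almost everywhere the infimum over each tail of the
  sequence vanishes. At such a level there are covers that are arbitrarily fine and have
  arbitrarily small sums.\<close>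

lemma AE_level_hausdorff_measure_0:
  assumes f: "\<And>n. f \<in> nearly_lipschitz \<alpha> n" and s: "1 < s"
  shows "AE r in lborel. hausdorff_measure s {p \<in> F_square. f p = r} = 0"
proof -
  \<comment> \<open>The covers are available for \<open>s\<close> only from this index on, hence the shift by \<open>k\<close>.\<close>
  obtain k :: nat where k: "1 / real (Suc k) < s - 1" using s nat_approx_posE[of "s - 1"] by auto
  have le: "1 + 1 / Suc (n + k) \<le> s" for n
  proof -
    have "1 / real (Suc (n + k)) \<le> 1 / real (Suc k)" by (intro divide_left_mono) auto
    then show ?thesis using k by linarith
  qed
  have "\<forall>n. \<exists>E. E \<in> borel_measurable lborel
      \<and> (\<integral>\<^sup>+r. E r \<partial>lborel) \<le> ennreal (4 * 2 powr s / Suc (n + k))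
      \<and> (\<forall>r. \<exists>U\<in>delta_covers (2 / Suc (n + k)) {p \<in> F_square. f p = r}. (\<Sum>i. diam_power s (U i)) \<le> E r)"
    by (intro allI level_cover_energy[OF f le])
  then have "\<exists>E. \<forall>n. E n \<in> borel_measurable lborel
      \<and> (\<integral>\<^sup>+r. E n r \<partial>lborel) \<le> ennreal (4 * 2 powr s / Suc (n + k))
      \<and> (\<forall>r. \<exists>U\<in>delta_covers (2 / Suc (n + k)) {p \<in> F_square. f p = r}. (\<Sum>i. diam_power s (U i)) \<le> E n r)"
    by (rule choice)
  then obtain E where E: "\<And>n. E n \<in> borel_measurable lborel"
    "\<And>n. (\<integral>\<^sup>+r. E n r \<partial>lborel) \<le> ennreal (4 * 2 powr s / Suc (n + k))"
    "\<And>n r. \<exists>U\<in>delta_covers (2 / Suc (n + k)) {p \<in> F_square. f p = r}. (\<Sum>i. diam_power s (U i)) \<le> E n r"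
    by blast
  have "AE r in lborel. (INF n. E (n + m) r) = 0" for m
  proof -
    have meas: "(\<lambda>r. INF n. E (n + m) r) \<in> borel_measurable lborel"
      using E(1) by (intro borel_measurable_INF) auto
    have "(\<integral>\<^sup>+r. (INF n. E (n + m) r) \<partial>lborel) \<le> 0"
    proof (rule ennreal_le_epsilon)
      fix e :: real assume e: "0 < e"
      have C: "0 < 4 * 2 powr s" by simp
      then obtain n where n: "1 / real (Suc n) < e / (4 * 2 powr s)"
        using e nat_approx_posE[of "e / (4 * 2 powr s)"] by auto
      have "(\<integral>\<^sup>+r. (INF n. E (n + m) r) \<partial>lborel) \<le> (\<integral>\<^sup>+r. E (n + m) r \<partial>lborel)"
        by (intro nn_integral_mono INF_lower) simp
      also have "\<dots> \<le> ennreal (4 * 2 powr s / Suc (n + m + k))" by (rule E(2))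
      also have "4 * 2 powr s / Suc (n + m + k) \<le> 4 * 2 powr s * (1 / Suc n)"
        by (simp add: frac_le)
      also have "\<dots> \<le> e" using n C by (simp add: field_simps)
      finally show "(\<integral>\<^sup>+r. (INF n. E (n + m) r) \<partial>lborel) \<le> 0 + ennreal e" by (simp add: ennreal_leI)
    qed
    then show ?thesis using nn_integral_0_iff_AE[OF meas] by simp
  qed
  then have "AE r in lborel. \<forall>m. (INF n. E (n + m) r) = 0" by (simp add: AE_all_countable)
  then show ?thesis
  proof (rule AE_mp[OF _ AE_I2], intro impI)
    fix r assume INF0: "\<forall>m. (INF n. E (n + m) r) = 0"
    show "hausdorff_measure s {p \<in> F_square. f p = r} = 0"
      unfolding hausdorff_measure_eq_0_iff
    proof (intro allI impI)
      fix \<epsilon> :: real assume \<epsilon>: "0 < \<epsilon>"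
      then obtain m where m: "1 / real (Suc m) < \<epsilon> / 2" using nat_approx_posE[of "\<epsilon> / 2"] by auto
      have "(INF n. E (n + m) r) < ennreal \<epsilon>" using INF0 \<epsilon> by simp
      then obtain n where n: "E (n + m) r < ennreal \<epsilon>" by (auto simp: INF_less_iff)
      obtain U where U: "U \<in> delta_covers (2 / Suc (n + m + k)) {p \<in> F_square. f p = r}"
        "(\<Sum>i. diam_power s (U i)) \<le> E (n + m) r" using E(3) by blast
      have "2 / real (Suc (n + m + k)) \<le> 2 * (1 / real (Suc m))" by (simp add: frac_le)
      then have "2 / real (Suc (n + m + k)) \<le> \<epsilon>" using m by linarith
      then show "\<exists>U\<in>delta_covers \<epsilon> {p \<in> F_square. f p = r}. (\<Sum>i. diam_power s (U i)) < ennreal \<epsilon>"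
        using delta_covers_mono[OF U(1)] U(2) n by (meson le_less_trans)
    qed
  qed
qed

lemma D_star_fun_le_1:
  assumes f: "\<And>n. f \<in> nearly_lipschitz \<alpha> n"
  shows "D_star_fun f F_square \<le> 1"
proof -
  have "AE r in lborel. \<forall>k::nat. hausdorff_measure (1 + 1 / Suc k) {p \<in> F_square. f p = r} = 0"
    unfolding AE_all_countable using f by (intro allI AE_level_hausdorff_measure_0) auto
  moreover have "level_dim f r F_square \<le> 1"
    if "\<forall>k::nat. hausdorff_measure (1 + 1 / Suc k) {p \<in> F_square. f p = r} = 0" for r
  proof (rule ereal_le_epsilon2)
    fix e :: real assume "0 < e"
    then obtain k where k: "1 / real (Suc k) < e" using nat_approx_posE by metis
    have "level_dim f r F_square \<le> ereal (1 + 1 / Suc k)"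
      unfolding level_dim_def hausdorff_dim_def using that by (intro Inf_lower) auto
    also have "\<dots> \<le> 1 + ereal e" using k by (simp add: one_ereal_def)
    finally show "level_dim f r F_square \<le> 1 + ereal e" .
  qed
  ultimately have "AE r in lborel. level_dim f r F_square \<le> 1"
    by (auto elim: AE_mp)
  then have ae: "AE r in lebesgue. level_dim f r F_square \<le> 1" by (rule AE_completion)
  show ?thesis
    unfolding D_star_fun_def
  proof (rule Sup_least, rule ccontr)
    fix d assume d: "d \<in> {d. 0 < emeasure lebesgue {r. d \<le> level_dim f r F_square}}" "\<not> d \<le> 1"
    have "AE r in lebesgue. \<not> d \<le> level_dim f r F_square"
      using ae by eventually_elim (use d(2) order_trans in blast)
    then have "emeasure lebesgue {r \<in> space lebesgue. d \<le> level_dim f r F_square} = 0"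
      by (rule emeasure_eq_0_AE)
    then show False using d(1) by simp
  qed
qed

lemma D_star_le_1:
  assumes \<alpha>: "0 < \<alpha>" "\<alpha> \<le> 1"
  shows "D_star \<alpha> F_square \<le> 1"
proof -
  interpret holder_setting \<alpha> F_square by (rule holder_setting_F_square[OF \<alpha>(1)])
  have "(INF f\<in>\<G>. D_star_fun f F_square) \<le> 1" if "\<G> \<in> dense_gdelta_sets \<alpha> F_square" for \<G>
  proof -
    from dense_gdelta_meets_residual[where V = "nearly_lipschitz \<alpha>", OF that openin_nearly_lipschitz[OF \<alpha>(1)] dense_nearly_lipschitz[OF \<alpha>]]
    obtain f where "f \<in> \<G>" "\<And>n. f \<in> nearly_lipschitz \<alpha> n" by blast
    then show ?thesis by (intro INF_lower2[of f]) (auto intro: D_star_fun_le_1)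
  qed
  then show ?thesis using \<alpha> by (auto simp: D_star_def intro: SUP_least)
qed

section \<open>The topological Hausdorff dimension\<close>

text \<open>An interval longer than two meshes of level \<open>k\<close> contains an entire gap of level \<open>k\<close>.\<close>

lemma gap_point_between:
  assumes "a < b"
  shows "\<exists>z. a < z \<and> z < b \<and> z \<notin> F0"
proof -
  obtain n where n: "(1/2::real) ^ n < (b - a) / 2"
    using real_arch_pow_inv[of "(b - a) / 2" "1/2"] assms by auto
  define k where "k = n + 2"
  have "grid k \<le> (1/2) ^ n"
    unfolding grid_def k_def by (rule power_decreasing) (auto simp: power2_eq_square)
  then have k: "2 \<le> k" "2 * grid k < b - a" using n by (auto simp: k_def)
  define j where "j = \<lfloor>a / grid k\<rfloor> + 1"
  have "a / grid k < of_int j" "of_int j \<le> a / grid k + 1" unfolding j_def by linarith+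
  then have j: "a < of_int j * grid k" "of_int j * grid k \<le> a + grid k"
    using grid_pos[of k] by (auto simp: field_simps)
  let ?z = "of_int j * grid k + gap_len k / 2"
  have len: "0 < gap_len k" "gap_len k \<le> grid k" by (auto simp: gap_len_le_grid)
  have "?z \<in> gaps k" unfolding mem_gaps using len by (intro exI[of _ j]) auto
  then have "?z \<notin> F0" using k(1) by (auto simp: F0_def)
  moreover have "a < ?z" "?z < b" using j k(2) len by linarith+
  ultimately show ?thesis by blast
qed

lemma gap_points_around:
  assumes "open A" "x \<in> A"
  shows "\<exists>z w. z < x \<and> x < w \<and> z \<notin> F0 \<and> w \<notin> F0 \<and> {z<..<w} \<subseteq> A"
proof -
  obtain e where e: "0 < e" "ball x e \<subseteq> A" using assms by (meson openE)
  obtain z where z: "x - e < z" "z < x" "z \<notin> F0" using gap_point_between[of "x - e" x] e by auto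
  obtain w where w: "x < w" "w < x + e" "w \<notin> F0" using gap_point_between[of x "x + e"] e by auto
  have "{z<..<w} \<subseteq> ball x e" using z w by (auto simp: ball_eq_greaterThanLessThan)
  with e z w show ?thesis by blast
qed

text \<open>An open rectangle whose sides lie on lines that miss the fractal has the same trace on the fractal as
  its closure.\<close>

lemma clopen_neighbourhood_F_square:
  assumes W: "openin (top_of_set F_square) W" and p: "p \<in> W"
  shows "\<exists>C. openin (top_of_set F_square) C \<and> closedin (top_of_set F_square) C \<and> p \<in> C \<and> C \<subseteq> W"
proof -
  obtain O' where O': "open O'" "W = F_square \<inter> O'" using W by (auto simp: openin_open)
  then obtain A B where AB: "open A" "open B" "p \<in> A \<times> B" "A \<times> B \<subseteq> O'"
    using p by (auto elim: open_prod_elim)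
  obtain a b where ab: "a < fst p" "fst p < b" "a \<notin> F0" "b \<notin> F0" "{a<..<b} \<subseteq> A"
    using gap_points_around[OF AB(1), of "fst p"] AB(3) by auto
  obtain c d where cd: "c < snd p" "snd p < d" "c \<notin> F0" "d \<notin> F0" "{c<..<d} \<subseteq> B"
    using gap_points_around[OF AB(2), of "snd p"] AB(3) by auto
  define C where "C = F_square \<inter> {a<..<b} \<times> {c<..<d}"
  have "C = F_square \<inter> {a..b} \<times> {c..d}"
    using ab(3,4) cd(3,4) unfolding C_def F_square_def
    by (auto simp: less_le)
  then have "closedin (top_of_set F_square) C"
    by (metis closedin_closed_Int closed_Times closed_atLeastAtMost)
  moreover have "openin (top_of_set F_square) C"
    unfolding C_def by (intro openin_open_Int open_Times open_greaterThanLessThan)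
  moreover have "p \<in> C" using p O' ab cd by (cases p) (auto simp: C_def)
  moreover have "C \<subseteq> W"
  proof -
    have "{a<..<b} \<times> {c<..<d} \<subseteq> O'" using ab(5) cd(5) AB(4) by blast
    then show ?thesis using O'(2) by (auto simp: C_def)
  qed
  ultimately show ?thesis by blast
qed

text \<open>Clopen sets have empty boundary, which counts as dimension \<open>-1\<close>; so the clopen sets are a basis that
  witnesses dimension \<open>0\<close>.\<close>

lemma top_hausdorff_dim_le_0_if_clopen_basis:
  assumes "X \<noteq> {}"
    and basis: "\<And>W p. openin (top_of_set X) W \<Longrightarrow> p \<in> W \<Longrightarrow>
      \<exists>C. openin (top_of_set X) C \<and> closedin (top_of_set X) C \<and> p \<in> C \<and> C \<subseteq> W"
  shows "top_hausdorff_dim X \<le> 0"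
proof -
  define \<U> where "\<U> = {C. openin (top_of_set X) C \<and> closedin (top_of_set X) C}"
  have "basis_of (top_of_set X) \<U>"
    unfolding basis_of_def
  proof (intro conjI ballI allI impI)
    fix W assume W: "openin (top_of_set X) W"
    have "\<Union>{C \<in> \<U>. C \<subseteq> W} = W" using basis[OF W] by (fastforce simp: \<U>_def)
    then show "\<exists>\<U>'. \<U>' \<subseteq> \<U> \<and> \<Union>\<U>' = W" by (intro exI[of _ "{C \<in> \<U>. C \<subseteq> W}"]) auto
  qed (simp add: \<U>_def)
  moreover have "hausdorff_dim_bd (top_of_set X frontier_of C) \<le> 0 - 1" if "C \<in> \<U>" for C
  proof -
    have "top_of_set X frontier_of C = {}" using that clopenin_eq_frontier_of[of "top_of_set X" C] by (simp add: \<U>_def)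
    then show ?thesis by (simp add: hausdorff_dim_bd_def)
  qed
  ultimately have "Inf {d. \<exists>\<U>. basis_of (top_of_set X) \<U> \<and>
      (\<forall>U\<in>\<U>. hausdorff_dim_bd (top_of_set X frontier_of U) \<le> d - 1)} \<le> 0"
    by (intro Inf_lower) auto
  then show ?thesis using assms(1) by (simp add: top_hausdorff_dim_def)
qed

lemma D_star_0_F_square: "D_star 0 F_square = 0"
proof -
  have "F_square \<noteq> {}" using half_in_F0 by (auto simp: F_square_def)
  then have "top_hausdorff_dim F_square \<le> 0"
    using clopen_neighbourhood_F_square by (rule top_hausdorff_dim_le_0_if_clopen_basis)
  then have "top_hausdorff_dim F_square - 1 \<le> 0 - 1" by (intro ereal_minus_mono) auto
  then have "top_hausdorff_dim F_square - 1 \<le> 0" by (rule order_trans) simp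
  then show ?thesis by (simp add: D_star_def)
qed

section \<open>The dimension function of the fractal\<close>

theorem theorem3p2:
  shows "(\<forall>\<alpha>::real. 0 < \<alpha> \<and> \<alpha> \<le> 1 \<longrightarrow> D_star \<alpha> F_square = 1) \<and> D_star 0 F_square = 0"
  using D_star_le_1 D_star_ge_1 D_star_0_F_square by (auto intro: antisym)

end
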